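(* Let $n\ge3$ be an integer. Then $$[\gamma_{3,n},\epsilon_{3,n})=\bigcup_{v=1}^{n-2}\mathscr I_{-1,v},$$ where $v$ runs over the single-letter words $1,\dots,n-2$. Furthermore, for each $v\in\check{\mathcal V}_n\setminus\{n-2\}$ the following is a partition (union of pairwise disjoint sets): $$\mathscr I_{-1,v}=\mathscr J_{-1,v}\cup\bigcup_{q=q'}^\infty\mathscr I_{-1,\Theta_q(v)},$$ where $q'=0$ unless $v=c_1$ is a word of a single letter, in which case $q'=-1$; when $v=1$ the (undefined) term $q=0$ is omitted. Moreover, $\mathscr I_{-1,n-2}=\mathscr J_{-1,n-2}=[\gamma_{3,n},\zeta_{-1,n-2})$.
   Context: Let $n\ge 3$ and $t=1+2\cos(\pi/n)$. Put $A=\begin{pmatrix}1&t\\0&1\end{pmatrix}$, $C=\begin{pmatrix}-1&1\\-1&0\end{pmatrix}$, acting on $\mathbb R\cup\{\infty\}$ by Möbius transformations. For $\alpha\in[0,1]$ let $\mathbb I_\alpha=[(\alpha-1)t,\alpha t)$, and define $T_\alpha=T_{3,n,\alpha}$ on $[(\alpha-1)t,\alpha t]$ by $T_\alpha(x)=A^kC^l\cdot x$, where $l\ge1$ is minimal with $C^l\cdot x\notin\mathbb I_\alpha$ and $k=-\lfloor (C^l\cdot x)/t+1-\alpha\rfloor$. The pair $(k,l)$ is the $\alpha$-digit of $x$ (undefined, and the orbit stops, if $C^l\cdot x=\infty$). Let $\ell_0(\alpha)=(\alpha-1)t$, $r_0(\alpha)=\alpha t$. The digit sequence of $\ell_0(\alpha)$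 is the sequence of $\alpha$-digits of $\ell_0(\alpha),T_\alpha(\ell_0(\alpha)),\dots$; when a digit is $(k,1)$ it is abbreviated to the simplified digit $k$. The number $\gamma_{3,n}\in(0,1)$ is the value of $\alpha$ with $C^{-1}\cdot\ell_0(\alpha)=r_0(\alpha)$, and $\epsilon_{3,n}\in(0,1)$ is the value of $\alpha$ with $A^{-1}C\cdot\ell_0(\alpha)=r_0(\alpha)$. Words. A word is a finite sequence $v=c_1d_1c_2d_2\cdots d_{s-1}c_s$ of positive integers, $s\ge1$. Put $v'=1(c_1-1)d_1c_2\cdots d_{s-1}c_s$ if $c_1\ne1$ and $v'=(d_1+1)c_2\cdots d_{s-1}c_s$ if $c_1=1$, $s>1$; in particular $v'=1(c-1)$ for $v=c>1$, and $v'=1$ for $v=1$. Define $\Theta_{-1}(c)=c+1$ for single-letter words $c\ge1$; $\Theta_q(1)=1q1$ for $q\ge1$ ($\Theta_0(1)$ is undefined); $\Theta_q(c)=c[1(c-1)]^q1c$ for $c>1$, $q\ge0$; and recursively, if $v=\Theta_p(u)=uv''$ for some $p\ge0$ and suffix $v''$, then $\Theta_q(v)=v(v')^qv''$ for $q\ge0$. $\mathcal V$ is the set of all words obtainable from the word $1$ by finite sequences of applications of the operators $\Theta_q$. The subset $\check{\mathcal V}_n\subset\mathcal V$ consists of those $v=c_1d_1\cdots c_s\in\mathcal V$ with all $c_i\le n-2$ and such that the only word with prefix $n-2$ is the single-letter word $v=n-2$ itself. Intervals. For $v=c_1d_1\cdots d_{s-1}c_s$ let $\underline d(-1,v)=(-1)^{c_1},(-2)^{d_1},\dots,(-2)^{d_{s-1}},(-1)^{c_s}$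 (exponents denote repetition). $\mathscr I_{-1,v}$ is the set of all $\alpha$ such that the digit sequence of $\ell_0(\alpha)$, in simplified digits, begins with $\underline d(-1,v)$ (all these digits having $l=1$), except that for single-letter words $v=c_1$ one moreover requires $\alpha\ge\gamma_{3,n}$. Let $L_{-1,v}=(A^{-1}C)^{c_s}(A^{-2}C)^{d_{s-1}}(A^{-1}C)^{c_{s-1}}\cdots(A^{-2}C)^{d_1}(A^{-1}C)^{c_1}A^{-1}$, and $\mathscr J_{-1,v}=[\eta_{-1,v},\zeta_{-1,v})$ where $\eta=\eta_{-1,v}$, $\zeta=\zeta_{-1,v}\in[0,1]$ are the parameters with $L_{-1,v}A\cdot\ell_0(\zeta)=r_0(\zeta)$ and $CA^{-1}CL_{-1,v}\cdot r_0(\eta)=C^{-1}\cdot\ell_0(\eta)$. *)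

theory Defs
  imports "HOL-Analysis.Analysis"
begin

datatype proj_line = Fin real | Infty

(* Only meaningful for invertible M. *)
definition moebius :: "real^2^2 \<Rightarrow> proj_line \<Rightarrow> proj_line" where
  "moebius M z = (case z of
      Fin x \<Rightarrow> (if M$2$1 * x + M$2$2 = 0 then Infty
               else Fin ((M$1$1 * x + M$1$2) / (M$2$1 * x + M$2$2)))
    | Infty \<Rightarrow> (if M$2$1 = 0 then Infty else Fin (M$1$1 / M$2$1)))"

definition mat_pow :: "real^2^2 \<Rightarrow> nat \<Rightarrow> real^2^2" where
  "mat_pow M k = (((**) M) ^^ k) (mat 1)"

definition mat_powi :: "real^2^2 \<Rightarrow> int \<Rightarrow> real^2^2" where
  "mat_powi M k = (if 0 \<le> k then mat_pow M (nat k) else mat_pow (matrix_inv M) (nat (- k)))"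

definition tpar :: "nat \<Rightarrow> real" where
  "tpar n = 1 + 2 * cos (pi / real n)"

definition matA :: "nat \<Rightarrow> real^2^2" where
  "matA n = vector [vector [1, tpar n], vector [0, 1]]"

definition matC :: "real^2^2" where
  "matC = vector [vector [-1, 1], vector [-1, 0]]"

definition ell0 :: "nat \<Rightarrow> real \<Rightarrow> real" where
  "ell0 n \<alpha> = (\<alpha> - 1) * tpar n"

definition r0 :: "nat \<Rightarrow> real \<Rightarrow> real" where
  "r0 n \<alpha> = \<alpha> * tpar n"

definition Ialpha :: "nat \<Rightarrow> real \<Rightarrow> proj_line set" where
  "Ialpha n \<alpha> = Fin ` {ell0 n \<alpha> ..< r0 n \<alpha>}"


definition exponentC :: "nat \<Rightarrow> real \<Rightarrow> proj_line \<Rightarrow> nat" where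
  "exponentC n \<alpha> z = (LEAST l. 1 \<le> l \<and> moebius (mat_pow matC l) z \<notin> Ialpha n \<alpha>)"

(* None: the image under the power of C is infinity, so the digit is undefined. *)
definition digit :: "nat \<Rightarrow> real \<Rightarrow> proj_line \<Rightarrow> (int \<times> nat) option" where
  "digit n \<alpha> z =
     (let l = exponentC n \<alpha> z in
      case moebius (mat_pow matC l) z of
        Infty \<Rightarrow> None
      | Fin y \<Rightarrow> Some (- \<lfloor>y / tpar n + 1 - \<alpha>\<rfloor>, l))"

(* As a formula this makes sense on the whole line, but it is only ever applied to points
   of the closed interval from ell0 to r0, which it maps into Ialpha. *)
definition Tmap :: "nat \<Rightarrow> real \<Rightarrow> proj_line \<Rightarrow> proj_line option" where
  "Tmap n \<alpha> z = map_option (\<lambda>(k, l). moebius (mat_powi (matA n) k ** mat_pow matC l) z) (digit n \<alpha> z)"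

primrec orbit :: "nat \<Rightarrow> real \<Rightarrow> nat \<Rightarrow> proj_line option" where
  "orbit n \<alpha> 0 = Some (Fin (ell0 n \<alpha>))"
| "orbit n \<alpha> (Suc i) = Option.bind (orbit n \<alpha> i) (Tmap n \<alpha>)"

definition digit_seq :: "nat \<Rightarrow> real \<Rightarrow> nat \<Rightarrow> (int \<times> nat) option" where
  "digit_seq n \<alpha> i = Option.bind (orbit n \<alpha> i) (digit n \<alpha>)"

definition gamma3 :: "nat \<Rightarrow> real" where
  "gamma3 n = (THE \<alpha>. \<alpha> \<in> {0<..<1} \<and>
     moebius (matrix_inv matC) (Fin (ell0 n \<alpha>)) = Fin (r0 n \<alpha>))"

definition epsilon3 :: "nat \<Rightarrow> real" where
  "epsilon3 n = (THE \<alpha>. \<alpha> \<in> {0<..<1} \<and>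
     moebius (matrix_inv (matA n) ** matC) (Fin (ell0 n \<alpha>)) = Fin (r0 n \<alpha>))"


text \<open>A word $c_1 d_1 c_2 \dots d_{s-1} c_s$ is the list of its letters, of odd length;
  the $c_i$ sit at the even list positions.\<close>

(* The modified word v'. It has even length unless v = [1]; the clause for [] is irrelevant. *)
fun wprime :: "nat list \<Rightarrow> nat list" where
  "wprime [] = []"
| "wprime [c] = (if c = 1 then [1] else [1, c - 1])"
| "wprime (c # d # w) = (if c = 1 then (d + 1) # w else 1 # (c - 1) # d # w)"

definition wpow :: "nat list \<Rightarrow> int \<Rightarrow> nat list" where
  "wpow w q = concat (replicate (nat q) w)"

(* Theta_rel q v w: applying the operator with index q to v is defined and yields w. *)
inductive Theta_rel :: "int \<Rightarrow> nat list \<Rightarrow> nat list \<Rightarrow> bool" where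
  minus_one: "1 \<le> c \<Longrightarrow> Theta_rel (-1) [c] [c + 1]"
| one: "1 \<le> q \<Longrightarrow> Theta_rel q [1] [1, nat q, 1]"
| single: "1 < c \<Longrightarrow> 0 \<le> q \<Longrightarrow> Theta_rel q [c] ([c] @ wpow [1, c - 1] q @ [1, c])"
| step: "0 \<le> p \<Longrightarrow> Theta_rel p u v \<Longrightarrow> v = u @ v'' \<Longrightarrow> 0 \<le> q \<Longrightarrow>
         Theta_rel q v (v @ wpow (wprime v) q @ v'')"

(* The suffix v'' used in the recursive rule is determined by v, so the result is unique
   whenever it is defined. *)
definition Theta :: "int \<Rightarrow> nat list \<Rightarrow> nat list" where
  "Theta q v = (THE w. Theta_rel q v w)"

inductive_set Vwords :: "nat list set" where
  base: "[1] \<in> Vwords"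
| app: "v \<in> Vwords \<Longrightarrow> Theta_rel q v w \<Longrightarrow> w \<in> Vwords"

definition Vcheck :: "nat \<Rightarrow> nat list set" where
  "Vcheck n = {v \<in> Vwords. (\<forall>i < length v. even i \<longrightarrow> v ! i \<le> n - 2) \<and>
                           (hd v = n - 2 \<longrightarrow> v = [n - 2])}"

(* The indices q >= q' for which the operator is defined at v. *)
definition qrange :: "nat list \<Rightarrow> int set" where
  "qrange v = (if v = [1] then {-1..} - {0} else if length v = 1 then {-1..} else {0..})"


fun dword :: "nat list \<Rightarrow> int list" where
  "dword [] = []"
| "dword [c] = replicate c (-1)"
| "dword (c # d # w) = replicate c (-1) @ replicate d (-2) @ dword w"

definition cylinder :: "nat \<Rightarrow> nat list \<Rightarrow> real set" where
  "cylinder n v = {\<alpha> \<in> {0..1}.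
      (\<forall>i < length (dword v). digit_seq n \<alpha> i = Some (dword v ! i, 1)) \<and>
      (length v = 1 \<longrightarrow> gamma3 n \<le> \<alpha>)}"

fun Wmat :: "nat \<Rightarrow> nat list \<Rightarrow> real^2^2" where
  "Wmat n [] = mat 1"
| "Wmat n [c] = mat_pow (mat_powi (matA n) (-1) ** matC) c"
| "Wmat n (c # d # w) =
     Wmat n w ** mat_pow (mat_powi (matA n) (-2) ** matC) d ** mat_pow (mat_powi (matA n) (-1) ** matC) c"

definition Lmat :: "nat \<Rightarrow> nat list \<Rightarrow> real^2^2" where
  "Lmat n v = Wmat n v ** matrix_inv (matA n)"

definition zeta_v :: "nat \<Rightarrow> nat list \<Rightarrow> real" where
  "zeta_v n v = (THE \<alpha>. \<alpha> \<in> {0..1} \<and>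
     moebius (Lmat n v ** matA n) (Fin (ell0 n \<alpha>)) = Fin (r0 n \<alpha>))"

definition eta_v :: "nat \<Rightarrow> nat list \<Rightarrow> real" where
  "eta_v n v = (THE \<alpha>. \<alpha> \<in> {0..1} \<and>
     moebius (matC ** matrix_inv (matA n) ** matC ** Lmat n v) (Fin (r0 n \<alpha>))
       = moebius (matrix_inv matC) (Fin (ell0 n \<alpha>)))"

definition Jint :: "nat \<Rightarrow> nat list \<Rightarrow> real set" where
  "Jint n v = {eta_v n v ..< zeta_v n v}"

end

theory Submission
  imports Defs "HOL-Library.Sublist"
begin

text \<open>Write \<open>x\<close> for the left end point of the interval, so that the right end point is \<open>x + t\<close>. A digit
  string of -1 and -2 is followed by \<open>x\<close> iff the corresponding increasing Moebius branches keep
  the orbit in \<open>[x, x + t)\<close>. With \<open>twin x = x / (1 - t x)\<close> the digit -2 acts on \<open>twin x\<close> as -1 acts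
  on \<open>x\<close>, hence \<open>v'\<close> acts on \<open>twin x\<close> as \<open>v\<close> acts on \<open>x\<close>, and the left end point of \<open>J\<^sub>v\<close> is the
  parameter where \<open>v\<close> maps \<open>x\<close> to \<open>twin x\<close>. Left of it, the image \<open>y\<close> of \<open>x\<close> under \<open>v\<close> lies below
  \<open>twin x\<close>; a lexicographic comparison shows that \<open>y\<close> follows either \<open>v'\<close>, which moves it further to
  the left, or the suffix that closes a child of \<open>v\<close>, but not both. As \<open>v'\<close> can be followed only
  finitely often, exactly one child of \<open>v\<close> is followed. That the parameter sets are intervals, and
  that their end points are the unique solutions of the defining equations, comes from
  the concavity of the quadratic polynomials describing these equations.\<close>

text \<open>The combinatorial core is that the parent of a word governs both of its continuations.
  If \<open>v\<close> has the digits \<open>u p (-1)\<close>, then \<open>v'\<close> is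
  \<open>p (-2) u\<close>, so the closing suffix \<open>p (-1)\<close> and \<open>v'\<close> first
  split at -1 against -2. These two images of a point differ by \<open>t\<close>, the length of the
  interval, so at most one stays inside; that one does is \<open>dichotomy\<close>, an induction
  along the tree for all points between the image of \<open>x\<close> under \<open>u\<close> and
  \<open>twin x\<close>. The analytic obstacle is that \<open>zeta_v\<close> and
  \<open>eta_v\<close> are unique solutions over all \<alpha> in [0,1], including parameters whose
  digits have nothing to do with \<open>v\<close>. Hence \<open>neg\<close>, which only asks for
  increasing branches, is kept apart from \<open>follows\<close>, and the signs of the quadratics
  are also needed at the extreme point -t. The number \<open>n\<close> enters through t - 1 = 2
  cos(pi/n): digit -1 acts as an elliptic map of order \<open>n\<close>, whose powers have quotients
  of sines as coefficients. This controls initial runs of -1 and ties the last word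
  \<open>n - 2\<close> to gamma.\<close>

lemma concave_quadratic:
  fixes A B C x y z :: real
  assumes "A \<le> 0" "x \<le> y" "y \<le> z"
  shows "(z - y) * (A * x\<^sup>2 + B * x + C) + (y - x) * (A * z\<^sup>2 + B * z + C)
    \<le> (z - x) * (A * y\<^sup>2 + B * y + C)"
proof -
  have "(z - x) * (A * y\<^sup>2 + B * y + C) -
     ((z - y) * (A * x\<^sup>2 + B * x + C) + (y - x) * (A * z\<^sup>2 + B * z + C))
     = (- A) * ((z - x) * ((y - x) * (z - y)))"
    by (simp add: algebra_simps power2_eq_square)
  also have "\<dots> \<ge> 0"
    using assms by (intro mult_nonneg_nonneg) auto
  finally show ?thesis by linarith
qed

lemma concave_quadratic_pos:
  fixes A B C :: real
  defines "q \<equiv> \<lambda>x. A * x\<^sup>2 + B * x + C"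
  assumes A: "A \<le> 0" and "0 < q x" "0 \<le> q z" "x \<le> y" "y < z"
  shows "0 < q y"
proof -
  have "(z - y) * q x + (y - x) * q z \<le> (z - x) * q y"
    unfolding q_def using A assms(5,6) by (intro concave_quadratic) auto
  moreover have "0 < (z - y) * q x" "0 \<le> (y - x) * q z"
    using assms by auto
  ultimately have "0 < (z - x) * q y" by linarith
  then show ?thesis using assms(5,6) by (simp add: zero_less_mult_iff)
qed

lemma concave_quadratic_neg:
  fixes A B C :: real
  defines "q \<equiv> \<lambda>x. A * x\<^sup>2 + B * x + C"
  assumes A: "A \<le> 0" and "0 < q x" "q y \<le> 0" "x < y" "y < z"
  shows "q z < 0"
proof (rule ccontr)
  assume "\<not> q z < 0"
  then have "0 < q y"
    unfolding q_def using assms(3,5,6) A by (intro concave_quadratic_pos[of A x B C z y]) (auto simp: q_def)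
  then show False using assms(4) by simp
qed

text \<open>Concavity forbids a return, so the sign is settled on the whole ray beyond the root and
  not only up to \<open>b\<close>. This later gives uniqueness over the full parameter
  range.\<close>

lemma concave_quadratic_crossing:
  fixes A B C :: real
  defines "q \<equiv> \<lambda>x. A * x\<^sup>2 + B * x + C"
  assumes A: "A \<le> 0" and a: "0 < q a" and b: "q b \<le> 0" and ab: "a < b"
  obtains r where "a < r" "r \<le> b" "q r = 0"
    "\<And>x. a \<le> x \<Longrightarrow> x < r \<Longrightarrow> 0 < q x" "\<And>x. r < x \<Longrightarrow> q x < 0"
proof -
  have "\<exists>r\<ge>a. r \<le> b \<and> q r = 0"
    using a b ab unfolding q_def by (intro IVT2') (auto intro!: continuous_intros)
  then obtain r where r: "a \<le> r" "r \<le> b" "q r = 0" by auto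
  have ar: "a < r"
  proof -
    have "a \<noteq> r" using a r(3) by auto
    then show ?thesis using r(1) by simp
  qed
  have qr: "0 \<le> q r" "q r \<le> 0" using r(3) by simp_all
  show ?thesis
  proof (rule that[OF ar r(2,3)])
    show "0 < q x" if "a \<le> x" "x < r" for x
      using concave_quadratic_pos[OF A a[unfolded q_def] qr(1)[unfolded q_def] that]
      by (simp add: q_def)
    show "q x < 0" if "r < x" for x
      using concave_quadratic_neg[OF A a[unfolded q_def] qr(2)[unfolded q_def] ar that]
      by (simp add: q_def)
  qed
qed

text \<open>Cross-multiplication also covers the value \<open>Infty\<close>: a nonzero determinant
  keeps numerator and denominator from vanishing together.\<close>

lemma moebius_Fin_eq_iff:
  assumes "det P \<noteq> 0" "det Q \<noteq> 0"
  shows "moebius P (Fin x) = moebius Q (Fin y) \<longleftrightarrow>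
    (P$1$1 * x + P$1$2) * (Q$2$1 * y + Q$2$2) = (P$2$1 * x + P$2$2) * (Q$1$1 * y + Q$1$2)"
proof -
  have nz: "M$1$1 * z + M$1$2 \<noteq> 0" if "det M \<noteq> 0" "M$2$1 * z + M$2$2 = 0"
    for M :: "real^2^2" and z
  proof
    assume "M$1$1 * z + M$1$2 = 0"
    then have 1: "M$1$2 = - M$1$1 * z" by linarith
    have 2: "M$2$2 = - M$2$1 * z" using that(2) by linarith
    have "det M = 0" unfolding det_2 1 2 by simp
    then show False using that by simp
  qed
  show ?thesis
    using nz[OF assms(1), of x] nz[OF assms(2), of y]
    by (auto simp: moebius_def frac_eq_eq mult.commute)
qed

section \<open>Branches and their itineraries\<close>

locale branch_maps =
  fixes n :: nat and t :: real
  assumes n3: "3 \<le> n" and t_eq: "t = tpar n"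
begin

lemma t_ge_2: "2 \<le> t"
proof -
  have "pi / real n \<le> pi / 3" using n3 by (intro divide_left_mono) auto
  moreover have "0 \<le> pi / real n" "pi / 3 \<le> pi" by auto
  ultimately have "cos (pi / 3) \<le> cos (pi / real n)"
    by (intro cos_monotone_0_pi_le)
  then show ?thesis by (simp add: t_eq tpar_def cos_60)
qed

lemma t_less_3: "t < 3"
proof -
  have "pi / real n \<le> pi / 1" using n3 by (intro divide_left_mono) auto
  moreover have "0 < pi / real n" using n3 by auto
  ultimately have "cos (pi / real n) < cos 0"
    by (intro cos_monotone_0_pi) auto
  then show ?thesis by (simp add: t_eq tpar_def)
qed

text \<open>The Moebius map of \<open>A^k C\<close>. It is increasing on each side of its pole 0;
  \<open>neg\<close> and \<open>follows\<close> stay on the negative side.\<close>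

definition branch :: "int \<Rightarrow> real \<Rightarrow> real" where
  "branch k x = 1 + real_of_int k * t - 1 / x"

abbreviation run :: "int list \<Rightarrow> real \<Rightarrow> real" where
  "run \<equiv> fold branch"

text \<open>Imposing no interval makes the domain closed to the left (\<open>neg_mono\<close>), so
  that signs can be carried to parameters where the word is not followed.\<close>

primrec neg :: "int list \<Rightarrow> real \<Rightarrow> bool" where
  "neg [] x \<longleftrightarrow> True"
| "neg (k # w) x \<longleftrightarrow> x < 0 \<and> neg w (branch k x)"

text \<open>The interval end \<open>l\<close> is separate from the starting point, because later
  orbit points and \<open>twin l\<close> are compared within one interval.\<close>

primrec follows :: "real \<Rightarrow> int list \<Rightarrow> real \<Rightarrow> bool" where
  "follows l [] x \<longleftrightarrow> True"
| "follows l (k # w) x \<longleftrightarrow> x < 0 \<and> l \<le> branch k x \<and> branch k x < l + t \<and> follows l w (branch k x)"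

lemma neg_append: "neg (u @ w) x \<longleftrightarrow> neg u x \<and> neg w (run u x)"
  by (induction u arbitrary: x) auto

lemma follows_append: "follows l (u @ w) x \<longleftrightarrow> follows l u x \<and> follows l w (run u x)"
  by (induction u arbitrary: x) auto

lemma follows_imp_neg: "follows l w x \<Longrightarrow> neg w x"
  by (induction w arbitrary: x) auto

lemma follows_run: "follows l w x \<Longrightarrow> l \<le> x \<Longrightarrow> l \<le> run w x"
  by (induction w arbitrary: x) auto

lemma follows_run_less: "follows l w x \<Longrightarrow> w \<noteq> [] \<Longrightarrow> run w x < l + t"
  by (induction w arbitrary: x) (auto, metis fold_simps(1))

lemma branch_strict_mono:
  assumes "y < 0" "x < y" shows "branch k x < branch k y"
proof -
  have "inverse y < inverse x" using assms by (intro less_imp_inverse_less_neg) auto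
  then show ?thesis by (simp add: branch_def divide_inverse)
qed

lemma branch_mono: "y < 0 \<Longrightarrow> x \<le> y \<Longrightarrow> branch k x \<le> branch k y"
  using branch_strict_mono by (cases "x = y") (auto simp: less_le)

lemma branch_shift: "branch (-1) x = branch (-2) x + t"
  by (simp add: branch_def algebra_simps)

lemma neg_mono: "neg w y \<Longrightarrow> x \<le> y \<Longrightarrow> neg w x"
  by (induction w arbitrary: x y) (auto intro: branch_mono)

lemma run_mono: "neg w y \<Longrightarrow> x \<le> y \<Longrightarrow> run w x \<le> run w y"
  by (induction w arbitrary: x y) (auto intro: branch_mono)

lemma run_strict_mono: "neg w y \<Longrightarrow> x < y \<Longrightarrow> run w x < run w y"
  by (induction w arbitrary: x y) (auto intro: branch_strict_mono)

text \<open>Digits are ordered oppositely to their numerical value: -1 labels the points further left.\<close>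

lemma follows_lex:
  assumes y: "follows l (p @ -1 # a) y" and z: "follows l (p @ -2 # b) z"
  shows "y < z"
proof (rule ccontr)
  assume "\<not> y < z"
  then have "z \<le> y" by simp
  have y': "neg p y" "run p y < 0" "branch (-1) (run p y) < l + t"
    using y by (auto simp: follows_append dest: follows_imp_neg)
  have "run p z \<le> run p y" using y' \<open>z \<le> y\<close> by (intro run_mono)
  then have "branch (-1) (run p z) \<le> branch (-1) (run p y)" using y' by (intro branch_mono)
  moreover have "l \<le> branch (-2) (run p z)" using z by (auto simp: follows_append)
  ultimately show False using y' branch_shift[of "run p z"] by linarith
qed

text \<open>A fixed point would be a root of x^2 + (t - 1) x + 1 = (x + 1)^2 + (t - 3) x, which is
  positive for negative \<open>x\<close> since t < 3.\<close>

lemma branch_minus_one_greater: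
  assumes "x < 0" shows "x < branch (-1) x"
proof -
  have "0 < (t - 3) * x"
    using assms t_less_3 by (intro mult_neg_neg) auto
  then have "0 < (x + 1)\<^sup>2 + (t - 3) * x"
    by (simp add: add_nonneg_pos)
  then have "0 < x * x + (t - 1) * x + 1"
    by (simp add: power2_eq_square algebra_simps)
  then show ?thesis using assms by (simp add: branch_def field_simps)
qed

text \<open>The map \<open>C^{-1} A C\<close>, which is the translation by \<open>t\<close> in the
  coordinate - 1 / x. It enters through the equation for \<open>eta_v\<close>, see
  \<open>eta_poly_moebius\<close>.\<close>

definition twin :: "real \<Rightarrow> real" where
  "twin x = x / (1 - t * x)"

lemma twin_denom: "x < 0 \<Longrightarrow> 0 < 1 - t * x"
  using t_ge_2 mult_nonneg_nonpos[of t x] by linarith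

lemma twin_neg: "x < 0 \<Longrightarrow> twin x < 0"
  using twin_denom by (simp add: twin_def divide_neg_pos)

lemma branch_twin:
  assumes "x < 0" shows "branch (-2) (twin x) = branch (-1) x"
proof -
  have "1 / twin x = 1 / x - t"
    using assms by (simp add: twin_def diff_divide_distrib)
  then show ?thesis by (simp add: branch_def)
qed

section \<open>Coefficients\<close>

definition digit_mat :: "int \<Rightarrow> real^2^2" where
  "digit_mat k = vector [vector [- (1 + real_of_int k * t), 1], vector [-1, 0]]"

primrec branch_mat :: "int list \<Rightarrow> real^2^2" where
  "branch_mat [] = mat 1"
| "branch_mat (k # w) = branch_mat w ** digit_mat k"

definition num :: "int list \<Rightarrow> real \<Rightarrow> real" where
  "num w x = branch_mat w $ 1 $ 1 * x + branch_mat w $ 1 $ 2"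

definition den :: "int list \<Rightarrow> real \<Rightarrow> real" where
  "den w x = branch_mat w $ 2 $ 1 * x + branch_mat w $ 2 $ 2"

lemma branch_mat_Cons_entries:
  "branch_mat (k # w) $ i $ 1 = - (1 + real_of_int k * t) * branch_mat w $ i $ 1 - branch_mat w $ i $ 2"
  "branch_mat (k # w) $ i $ 2 = branch_mat w $ i $ 1"
  by (simp_all add: matrix_matrix_mult_def sum_2 digit_mat_def)

lemma num_den_Nil [simp]: "num [] x = x" "den [] x = 1"
  by (simp_all add: num_def den_def mat_def)

lemma num_Cons: "x \<noteq> 0 \<Longrightarrow> num (k # w) x = - x * num w (branch k x)"
  unfolding num_def branch_mat_Cons_entries branch_def by (simp add: field_simps)

lemma den_Cons: "x \<noteq> 0 \<Longrightarrow> den (k # w) x = - x * den w (branch k x)"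
  unfolding den_def branch_mat_Cons_entries branch_def by (simp add: field_simps)

lemma det_digit_mat: "det (digit_mat k) = 1"
  by (simp add: det_2 digit_mat_def)

lemma det_branch_mat: "det (branch_mat w) = 1"
  by (induction w) (auto simp: det_mul det_digit_mat)

text \<open>By \<open>den_Cons\<close> the denominator is the product of \<open>- y\<close> over the
  points \<open>y\<close> to which a digit is applied. Working with fixed matrices, not projective
  classes, is what fixes this sign.\<close>

lemma den_pos: "neg w x \<Longrightarrow> 0 < den w x"
  by (induction w arbitrary: x) (auto simp: den_Cons mult_neg_pos)

lemma num_eq: "neg w x \<Longrightarrow> num w x = run w x * den w x"
  by (induction w arbitrary: x) (auto simp: den_Cons num_Cons)

text \<open>The denominator is affine and, by \<open>neg_mono\<close>, positive on a whole left ray;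
  a positive slope would make it vanish there.\<close>

lemma branch_mat_21_nonpos:
  assumes "neg w x" shows "branch_mat w $ 2 $ 1 \<le> 0"
proof (rule ccontr)
  assume c: "\<not> ?thesis"
  define z where "z = min x (- branch_mat w $ 2 $ 2 / branch_mat w $ 2 $ 1)"
  have "0 < den w z" using assms by (intro den_pos neg_mono[OF assms]) (simp add: z_def)
  moreover have "branch_mat w $ 2 $ 1 * z \<le> branch_mat w $ 2 $ 1 * (- branch_mat w $ 2 $ 2 / branch_mat w $ 2 $ 1)"
    using c by (intro mult_left_mono) (auto simp: z_def)
  then have "den w z \<le> 0" using c by (simp add: den_def)
  ultimately show False by simp
qed

text \<open>The numerator is affine and negative on a left ray, so its slope is at least 0; slope 0
  is incompatible with determinant 1 and the sign of the entry (2,1).\<close>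

lemma branch_mat_11_pos:
  assumes "neg w x" "run w x < 0" shows "0 < branch_mat w $ 1 $ 1"
proof -
  have neg: "num w z < 0" if "z \<le> x" for z
  proof -
    have "neg w z" "run w z < 0"
      using that assms neg_mono[OF assms(1)] run_mono[OF assms(1), of z] by auto
    then show ?thesis using den_pos num_eq by (simp add: mult_neg_pos)
  qed
  have "0 \<le> branch_mat w $ 1 $ 1"
  proof (rule ccontr)
    assume c: "\<not> ?thesis"
    define z where "z = min x (- branch_mat w $ 1 $ 2 / branch_mat w $ 1 $ 1)"
    have "num w z < 0" by (intro neg) (simp add: z_def)
    moreover have "branch_mat w $ 1 $ 1 * (- branch_mat w $ 1 $ 2 / branch_mat w $ 1 $ 1) \<le> branch_mat w $ 1 $ 1 * z"
      using c by (intro mult_left_mono_neg) (auto simp: z_def)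
    then have "0 \<le> num w z" using c by (simp add: num_def)
    ultimately show False by simp
  qed
  moreover have "branch_mat w $ 1 $ 1 \<noteq> 0"
  proof
    assume 0: "branch_mat w $ 1 $ 1 = 0"
    then have "branch_mat w $ 1 $ 2 < 0" using neg[of x] by (simp add: num_def)
    moreover have "branch_mat w $ 1 $ 2 * branch_mat w $ 2 $ 1 = -1"
      using det_branch_mat[of w] 0 by (simp add: det_2)
    ultimately show False
      using branch_mat_21_nonpos[OF assms(1)] mult_nonpos_nonpos[of "branch_mat w $ 1 $ 2" "branch_mat w $ 2 $ 1"] by linarith
  qed
  ultimately show ?thesis by simp
qed

lemma branch_mat_12_pos:
  assumes "neg w x" "run w x < 0" "w \<noteq> []" shows "0 < branch_mat w $ 1 $ 2"
  using assms branch_mat_11_pos by (cases w) (auto simp: branch_mat_Cons_entries simp del: branch_mat.simps)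

text \<open>The sign of these two quadratics compares the value of a branch with \<open>x + t\<close> and with
  \<open>twin x\<close>; the second is concave in the coordinate \<open>- 1 / x\<close>.\<close>

definition zeta_poly :: "int list \<Rightarrow> real \<Rightarrow> real" where
  "zeta_poly w x = (x + t) * den w x - num w x"

definition eta_poly :: "int list \<Rightarrow> real \<Rightarrow> real" where
  "eta_poly w x = x * den w x - num w x * (1 - t * x)"

lemma zeta_poly_factor: "neg w x \<Longrightarrow> zeta_poly w x = (x + t - run w x) * den w x"
  by (simp add: zeta_poly_def num_eq algebra_simps)

lemma zeta_poly_pos_iff: "neg w x \<Longrightarrow> 0 < zeta_poly w x \<longleftrightarrow> run w x < x + t"
  using den_pos[of w x] by (auto simp: zeta_poly_factor zero_less_mult_iff)

lemma zeta_poly_zero_iff: "neg w x \<Longrightarrow> zeta_poly w x = 0 \<longleftrightarrow> run w x = x + t"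
  using den_pos[of w x] by (auto simp: zeta_poly_factor)

lemma eta_poly_factor: "neg w x \<Longrightarrow> x < 0 \<Longrightarrow> eta_poly w x = (twin x - run w x) * (den w x * (1 - t * x))"
  using twin_denom[of x] by (simp add: eta_poly_def num_eq twin_def field_simps)

lemma eta_poly_pos_iff: "neg w x \<Longrightarrow> x < 0 \<Longrightarrow> 0 < eta_poly w x \<longleftrightarrow> run w x < twin x"
  using mult_pos_pos[OF den_pos[of w x] twin_denom[of x]]
  by (simp only: eta_poly_factor zero_less_mult_iff[of "twin x - run w x"]) auto

lemma eta_poly_zero_iff: "neg w x \<Longrightarrow> x < 0 \<Longrightarrow> eta_poly w x = 0 \<longleftrightarrow> run w x = twin x"
  using den_pos[of w x] twin_denom[of x] by (auto simp add: eta_poly_factor)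

lemma zeta_poly_quadratic:
  "zeta_poly w x = branch_mat w $ 2 $ 1 * x\<^sup>2 + (branch_mat w $ 2 $ 2 + t * branch_mat w $ 2 $ 1 - branch_mat w $ 1 $ 1) * x
    + (t * branch_mat w $ 2 $ 2 - branch_mat w $ 1 $ 2)"
  by (simp add: zeta_poly_def num_def den_def power2_eq_square algebra_simps)

text \<open>In \<open>x\<close> the leading coefficient has no evident sign. In the coordinate - 1 /
  x, where \<open>twin\<close> is a translation, it is minus the entry (1,2), whose sign
  \<open>branch_mat_12_pos\<close> provides.\<close>

lemma eta_poly_quadratic:
  assumes "x < 0"
  shows "eta_poly w x = x\<^sup>2 * (- branch_mat w $ 1 $ 2 * (- 1 / x)\<^sup>2
    + (branch_mat w $ 1 $ 1 - branch_mat w $ 2 $ 2 - t * branch_mat w $ 1 $ 2) * (- 1 / x) + (branch_mat w $ 2 $ 1 + t * branch_mat w $ 1 $ 1))"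
  using assms by (simp add: eta_poly_def num_def den_def power2_eq_square field_simps)

lemma zeta_poly_crossing:
  assumes "neg w c" "0 < zeta_poly w a" "zeta_poly w b \<le> 0" "a < b"
  obtains r where "a < r" "r \<le> b" "zeta_poly w r = 0"
    "\<And>x. a \<le> x \<Longrightarrow> x < r \<Longrightarrow> 0 < zeta_poly w x" "\<And>x. r < x \<Longrightarrow> zeta_poly w x < 0"
  using concave_quadratic_crossing[of "branch_mat w $ 2 $ 1" a "branch_mat w $ 2 $ 2 + t * branch_mat w $ 2 $ 1 - branch_mat w $ 1 $ 1"
      "t * branch_mat w $ 2 $ 2 - branch_mat w $ 1 $ 2" b] branch_mat_21_nonpos[OF assms(1)] assms(2-4)
  unfolding zeta_poly_quadratic[symmetric] by blast

lemma eta_poly_crossing: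
  assumes c: "neg w c" "run w c < 0" "w \<noteq> []"
    and ab: "0 < eta_poly w a" "eta_poly w b \<le> 0" "a < b" "b < 0"
  obtains r where "a < r" "r \<le> b" "eta_poly w r = 0"
    "\<And>x. a \<le> x \<Longrightarrow> x < r \<Longrightarrow> 0 < eta_poly w x" "\<And>x. r < x \<Longrightarrow> x \<le> 0 \<Longrightarrow> eta_poly w x < 0"
proof -
  define q where "q s = - branch_mat w $ 1 $ 2 * s\<^sup>2 + (branch_mat w $ 1 $ 1 - branch_mat w $ 2 $ 2 - t * branch_mat w $ 1 $ 2) * s
    + (branch_mat w $ 2 $ 1 + t * branch_mat w $ 1 $ 1)" for s
  have b0: "0 < branch_mat w $ 1 $ 2" using c by (rule branch_mat_12_pos)
  have eq: "eta_poly w x = x\<^sup>2 * q (- 1 / x)" if "x < 0" for x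
    using eta_poly_quadratic[OF that] by (simp add: q_def)
  have pos: "0 < eta_poly w x \<longleftrightarrow> 0 < q (- 1 / x)" and neg: "eta_poly w x < 0 \<longleftrightarrow> q (- 1 / x) < 0" if "x < 0" for x
    using that by (auto simp: eq zero_less_mult_iff mult_less_0_iff)
  have a: "a < 0" using ab by simp
  have less: "- 1 / x < - 1 / y \<longleftrightarrow> x < y" if "x < 0" "y < 0" for x y :: real
    using that by (simp add: field_simps)
  have "0 < q (- 1 / a)" "q (- 1 / b) \<le> 0" "- 1 / a < - 1 / b"
    using pos[OF a] pos[OF ab(4)] ab less a by auto
  then obtain s where s: "- 1 / a < s" "s \<le> - 1 / b" "q s = 0"
    and sp: "\<And>x. - 1 / a \<le> x \<Longrightarrow> x < s \<Longrightarrow> 0 < q x" and sn: "\<And>x. s < x \<Longrightarrow> q x < 0"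
    using b0 unfolding q_def by (elim concave_quadratic_crossing[rotated]) auto
  have s0: "0 < s" using s(1) a by (meson divide_neg_neg less_trans neg_less_0_iff_less zero_less_one)
  define r where "r = - 1 / s"
  have r: "r < 0" "s = - 1 / r" using s0 by (auto simp: r_def)
  show ?thesis
  proof
    show "a < r" using s(1) less[OF a r(1)] r(2) by simp
    show "r \<le> b" using s(2) less[OF ab(4) r(1)] r(2) by linarith
    show "eta_poly w r = 0" using s(3) eq[OF r(1)] r(2) by simp
    show "0 < eta_poly w x" if "a \<le> x" "x < r" for x
    proof -
      have x: "x < 0" using that r by simp
      show ?thesis unfolding pos[OF x] using that less[OF x r(1)] less[OF x a] r(2)
        by (intro sp) linarith+
    qed
    show "eta_poly w x < 0" if "r < x" "x \<le> 0" for x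
    \<comment> \<open>The coordinate - 1 / x misses 0, which is the parameter \<alpha> = 1; there
      the quadratic equals minus the entry (1,2).\<close>
    proof (cases "x = 0")
      case True
      then show ?thesis using b0 by (simp add: eta_poly_def num_def)
    next
      case False
      then have x: "x < 0" using that by simp
      show ?thesis unfolding neg[OF x] using that less[OF r(1) x] r(2) by (intro sn) linarith
    qed
  qed
qed

end

section \<open>The tree of digit words\<close>

definition rep :: "nat \<Rightarrow> 'a list \<Rightarrow> 'a list" where
  "rep m w = concat (replicate m w)"

lemma rep_0 [simp]: "rep 0 w = []"
  by (simp add: rep_def)

lemma rep_Suc [simp]: "rep (Suc m) w = w @ rep m w"
  by (simp add: rep_def)

lemma rep_comm: "rep m w @ w = w @ rep m w"
  by (induction m) auto

lemma rep_comm_assoc: "rep m w @ w @ x = w @ rep m w @ x"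
  using rep_comm[of m w] by (metis append_assoc)

lemma rep_add: "rep (i + j) w = rep i w @ rep j w"
  by (induction i) auto

text \<open>\<open>node_word u p\<close> and \<open>node_prime u p\<close> are the digit forms of \<open>v\<close> and \<open>v'\<close>, where \<open>v\<close> is a child of the word
  with digits \<open>u\<close>; the two agree except in the first digit (\<open>node_tl\<close>).\<close>

definition node_word :: "int list \<Rightarrow> int list \<Rightarrow> int list" where
  "node_word u p = u @ p @ [-1]"

definition node_prime :: "int list \<Rightarrow> int list \<Rightarrow> int list" where
  "node_prime u p = p @ -2 # u"

text \<open>The suffix \<open>p @ [-1]\<close> is the part \<open>v''\<close> that closes every
  child of \<open>v\<close>. Single letters fit in with \<open>p = []\<close>: child 0 of the letter
  \<open>c\<close> is \<open>c + 1\<close>, so the operator of index -1 is covered as well.\<close>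

inductive node :: "int list \<Rightarrow> int list \<Rightarrow> bool" where
  base: "node [] []"
| step: "node u p \<Longrightarrow> node (node_word u p) (rep m (node_prime u p) @ p)"

text \<open>Moving the last copy of \<open>v'\<close> in front of its power lets both new words
  continue with the tail that \<open>v\<close> and \<open>v'\<close> already share.\<close>

lemma node_tl:
  assumes "node u p"
  obtains w where "node_word u p = -1 # w" "node_prime u p = -2 # w"
  using assms
proof (induction arbitrary: thesis)
  case base
  then show ?case by (simp add: node_word_def node_prime_def)
next
  case (step u p m)
  from step.IH obtain w where w: "node_word u p = -1 # w" "node_prime u p = -2 # w" by blast
  have "node_prime (node_word u p) (rep m (node_prime u p) @ p) = rep m (node_prime u p) @ node_prime u p @ p @ [-1]"
    by (simp add: node_prime_def node_word_def)
  also have "\<dots> = node_prime u p @ rep m (node_prime u p) @ p @ [-1]"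
    by (rule rep_comm_assoc)
  finally have 1: "node_prime (node_word u p) (rep m (node_prime u p) @ p) = -2 # w @ rep m (node_prime u p) @ p @ [-1]"
    by (simp add: w)
  have 2: "node_word (node_word u p) (rep m (node_prime u p) @ p) = -1 # w @ rep m (node_prime u p) @ p @ [-1]"
    unfolding node_word_def[of "node_word u p"] by (simp add: w)
  show ?case by (rule step.prems[OF 2 1])
qed

text \<open>The common tail of \<open>node_tl\<close> ends in \<open>u\<close>, as the form
  \<open>p @ -2 # u\<close> shows. A word thus also ends with its parent, which makes their images
  comparable by monotonicity.\<close>

lemma node_suffix:
  assumes "node u p"
  obtains r where "node_word u p = r @ u" "r \<noteq> []"
proof -
  obtain w where w: "node_word u p = -1 # w" "node_prime u p = -2 # w" using assms by (rule node_tl)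
  show ?thesis
  proof (cases p)
    case Nil
    then show ?thesis using that[of "[-1]"] w by (simp add: node_prime_def)
  next
    case (Cons k p')
    then show ?thesis using that[of "-1 # p' @ [-2]"] w by (simp add: node_prime_def)
  qed
qed

lemma node_word_child: "node_word (node_word u p) (rep m (node_prime u p) @ p) = node_word u p @ rep m (node_prime u p) @ p @ [-1]"
  by (simp add: node_word_def)

lemma node_prime_child: "node_prime (node_word u p) (rep m (node_prime u p) @ p) = rep (Suc m) (node_prime u p) @ p @ [-1]"
proof -
  have "node_prime (node_word u p) (rep m (node_prime u p) @ p) = rep m (node_prime u p) @ node_prime u p @ p @ [-1]"
    by (simp add: node_prime_def node_word_def)
  then show ?thesis using rep_comm_assoc[of m "node_prime u p" "p @ [-1]"] by simp
qed

lemma node_ones: "node (replicate c (-1)) [] \<and> node_word (replicate c (-1)) [] = replicate (Suc c) (-1)"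
proof (induction c)
  case 0
  then show ?case using node.base by (simp add: node_word_def)
next
  case (Suc c)
  then have "node (node_word (replicate c (-1)) []) (rep 0 (node_prime (replicate c (-1)) []) @ [])"
    by (intro node.step) simp
  then show ?case using Suc by (simp add: node_word_def replicate_append_same)
qed

context branch_maps
begin

section \<open>The partition at a fixed parameter\<close>

lemma follows_node_word: "follows l (node_word u p) x \<longleftrightarrow> follows l u x \<and> follows l (p @ [-1]) (run u x)"
  by (simp add: node_word_def follows_append)

lemma follows_node_prime_twin:
  assumes "node u p" "follows l (node_word u p) x"
  shows "follows l (node_prime u p) (twin x)"
proof -
  obtain w where "node_word u p = -1 # w" "node_prime u p = -2 # w" using assms(1) by (rule node_tl)
  then show ?thesis using assms(2) branch_twin[of x] twin_neg[of x] by auto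
qed

lemma run_node_prime_twin:
  assumes "node u p" "x < 0"
  shows "run (node_prime u p) (twin x) = run (node_word u p) x"
proof -
  obtain w where "node_word u p = -1 # w" "node_prime u p = -2 # w" using assms(1) by (rule node_tl)
  then show ?thesis using branch_twin[OF assms(2)] by simp
qed

lemma follows_node_word_neg: "node u p \<Longrightarrow> follows l (node_word u p) x \<Longrightarrow> x < 0"
  by (erule node_tl) simp

lemma follows_s_less_node_prime: "follows l (p @ [-1]) y \<Longrightarrow> follows l (node_prime u p) z \<Longrightarrow> y < z"
  unfolding node_prime_def by (rule follows_lex)

text \<open>From \<open>run u x\<close> the orbit takes \<open>p (-1)\<close>, from
  \<open>twin x\<close> it takes \<open>v'\<close>, that is \<open>p (-2) u\<close>; the split after
  \<open>p\<close> decides.\<close>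

lemma run_u_less_twin:
  assumes "node u p" "follows l (node_word u p) x" shows "run u x < twin x"
  using follows_s_less_node_prime[OF _ follows_node_prime_twin[OF assms]] assms(2) by (simp add: follows_node_word)

lemma le_run_u: "follows l (node_word u p) l \<Longrightarrow> l \<le> run u l"
  by (auto simp: follows_node_word intro: follows_run)

lemma run_u_le_run_node_word:
  assumes "node u p" "follows l (node_word u p) l" shows "run u l \<le> run (node_word u p) l"
proof -
  obtain r where r: "node_word u p = r @ u" using assms(1) by (rule node_suffix)
  have "follows l r l" "neg u (run r l)" using assms(2) by (auto simp: r follows_append dest: follows_imp_neg)
  then show ?thesis unfolding r by (auto intro!: run_mono intro: follows_run)
qed

text \<open>For the lower bound, \<open>v'\<close> ends in \<open>u\<close>, applied to a point not
  left of \<open>l\<close>; for the upper one, \<open>v'\<close> maps \<open>twin l\<close> to the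
  image of \<open>l\<close> under \<open>v\<close>. If that image is below \<open>twin l\<close>,
  following \<open>v'\<close> never leaves the range from \<open>run u l\<close> to
  \<open>twin l\<close>.\<close>

lemma run_node_prime_bounds:
  assumes "node u p" and l: "follows l (node_word u p) l"
    and z: "l \<le> z" "z < twin l" "follows l (node_prime u p) z"
  shows "run u l \<le> run (node_prime u p) z" "run (node_prime u p) z < run (node_word u p) l"
proof -
  have "run (node_prime u p) z = run u (run (p @ [-2]) z)" by (simp add: node_prime_def)
  moreover have "l \<le> run (p @ [-2]) z" "neg u (run (p @ [-2]) z)"
    using z(1,3) follows_run[of l "p @ [-2]" z] by (auto simp: node_prime_def follows_append dest: follows_imp_neg)
  ultimately show "run u l \<le> run (node_prime u p) z" by (simp add: run_mono)
  have "neg (node_prime u p) (twin l)"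
    using follows_node_prime_twin[OF assms(1) l] by (rule follows_imp_neg)
  then have "run (node_prime u p) z < run (node_prime u p) (twin l)" using z by (intro run_strict_mono)
  then show "run (node_prime u p) z < run (node_word u p) l"
    using run_node_prime_twin[OF assms(1) follows_node_word_neg[OF assms(1) l]] by simp
qed

text \<open>The alternative \<open>dich\<close> is a premise because this iteration is used inside
  the induction that proves it.\<close>

lemma follows_chain:
  assumes nd: "node u p" and l: "follows l (node_word u p) l" and Y: "run (node_word u p) l < twin l"
    and dich: "\<And>z. run u l \<le> z \<Longrightarrow> z < twin l \<Longrightarrow> follows l (p @ [-1]) z \<or> follows l (node_prime u p) z"
    and z: "run u l \<le> z" "z < twin l"
  shows "(\<exists>i<j. follows l (rep i (node_prime u p) @ p @ [-1]) z) \<or>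
    (follows l (rep j (node_prime u p)) z \<and> run u l \<le> run (rep j (node_prime u p)) z \<and> run (rep j (node_prime u p)) z < twin l)"
  using z
proof (induction j arbitrary: z)
  case 0
  then show ?case by simp
next
  case (Suc j)
  from dich[OF Suc.prems] show ?case
  proof
    assume "follows l (p @ [-1]) z"
    then show ?thesis by (intro disjI1 exI[of _ 0]) simp
  next
    assume z: "follows l (node_prime u p) z"
    let ?z = "run (node_prime u p) z"
    have "l \<le> z" using le_run_u[OF l] Suc.prems by simp
    then have b: "run u l \<le> ?z" "?z < twin l"
      using run_node_prime_bounds[OF nd l _ Suc.prems(2) z] Y by auto
    from Suc.IH[OF b] show ?thesis
    proof
      assume "\<exists>i<j. follows l (rep i (node_prime u p) @ p @ [- 1]) ?z"
      then obtain i where "i < j" "follows l (rep i (node_prime u p) @ p @ [- 1]) ?z" by blast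
      then have "Suc i < Suc j \<and> follows l (rep (Suc i) (node_prime u p) @ p @ [- 1]) z"
        using z by (simp add: follows_append)
      then show ?thesis by blast
    next
      assume "follows l (rep j (node_prime u p)) ?z \<and> run u l \<le> run (rep j (node_prime u p)) ?z \<and> run (rep j (node_prime u p)) ?z < twin l"
      then show ?thesis using z by (simp add: follows_append)
    qed
  qed
qed

lemma rep_lex:
  assumes "i < j" "follows l (rep i (node_prime u p) @ p @ [-1]) y" "follows l (rep j (node_prime u p)) z"
  shows "y < z"
proof -
  obtain k where j: "j = i + Suc k" using assms(1) less_iff_Suc_add by auto
  have "rep j (node_prime u p) = (rep i (node_prime u p) @ p) @ -2 # (u @ rep k (node_prime u p))"
    by (simp add: j rep_add node_prime_def del: add_Suc_right)
  then show ?thesis using assms(2,3) follows_lex[of l "rep i (node_prime u p) @ p" "[]" y] by simp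
qed

lemma follows_node_word_child:
  "follows l (node_word (node_word u p) (rep m (node_prime u p) @ p)) x \<longleftrightarrow>
    follows l (node_word u p) x \<and> follows l (rep m (node_prime u p) @ p @ [-1]) (run (node_word u p) x)"
  by (simp add: node_word_child follows_append)

lemma child_imp_less_twin:
  assumes "node u p" "follows l (node_word (node_word u p) (rep m (node_prime u p) @ p)) x"
  shows "run (node_word u p) x < twin x"
  using run_u_less_twin[OF node.step[OF assms(1)] assms(2)] .

text \<open>In the base case the images under -1 and -2 differ by \<open>t\<close>, and z < twin l
  keeps the lower one in range. In the step, up to m + 1 copies of the parent's \<open>v'\<close>
  are peeled off: closing after fewer than \<open>m\<close> copies would put \<open>z\<close> left
  of the image of \<open>l\<close> under \<open>v\<close>, and m + 2 copies would put it right of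
  \<open>twin l\<close>.\<close>

lemma dichotomy:
  assumes "node u p" "follows l (node_word u p) l" "run u l \<le> z" "z < twin l"
  shows "follows l (p @ [-1]) z \<or> follows l (node_prime u p) z"
  using assms
proof (induction arbitrary: z)
  case base
  then have l: "l < 0" "l \<le> branch (-1) l" "branch (-1) l < l + t" by (auto simp: node_word_def)
  have z: "z < 0" "l \<le> z" using base twin_neg[OF l(1)] by auto
  have "branch (-2) z < branch (-2) (twin l)"
    using base twin_neg[OF l(1)] by (intro branch_strict_mono) auto
  moreover have "branch (-1) l \<le> branch (-1) z" using z by (intro branch_mono)
  ultimately show ?case
    using l z branch_twin[OF l(1)] branch_shift[of z] t_ge_2 by (auto simp: node_prime_def)
next
  case (step u p m)
  let ?v' = "node_prime u p"
  have nd: "node (node_word u p) (rep m ?v' @ p)" using step.hyps by (rule node.step)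
  from step.prems(1) have l: "follows l (node_word u p) l" and Yf: "follows l (rep m ?v' @ p @ [-1]) (run (node_word u p) l)"
    by (auto simp: follows_node_word_child)
  have Y: "run (node_word u p) l < twin l" using child_imp_less_twin step.hyps step.prems(1) by blast
  have lz: "run u l \<le> z" using step.prems(2) run_u_le_run_node_word[OF step.hyps l] by simp
  from follows_chain[OF step.hyps l Y step.IH[OF l] lz step.prems(3), of "Suc m"] show ?case
  proof
    assume "\<exists>i<Suc m. follows l (rep i ?v' @ p @ [- 1]) z"
    then obtain i where i: "i < Suc m" "follows l (rep i ?v' @ p @ [- 1]) z" by blast
    show ?thesis
    proof (cases "i = m")
      case True
      then show ?thesis using i by simp
    next
      case False
      then have "z < run (node_word u p) l"
        using i Yf by (intro rep_lex[of i m]) (auto simp: follows_append)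
      then show ?thesis using step.prems(2) by simp
    qed
  next
    assume *: "follows l (rep (Suc m) ?v') z \<and> run u l \<le> run (rep (Suc m) ?v') z \<and> run (rep (Suc m) ?v') z < twin l"
    then have "follows l (p @ [-1]) (run (rep (Suc m) ?v') z) \<or> follows l ?v' (run (rep (Suc m) ?v') z)"
      using step.IH[OF l] by blast
    then show ?thesis
    proof
      assume "follows l (p @ [-1]) (run (rep (Suc m) ?v') z)"
      then have "follows l (rep (Suc m) ?v' @ p @ [-1]) z"
        using * by (simp only: follows_append)
      then show ?thesis unfolding node_prime_child by simp
    next
      assume a: "follows l ?v' (run (rep (Suc m) ?v') z)"
      have "rep (Suc m) ?v' @ ?v' = rep (Suc (Suc m)) ?v'" by (simp add: rep_comm)
      then have "follows l (rep (Suc (Suc m)) ?v') z"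
        using * a by (metis follows_append)
      moreover have "follows l (rep (Suc m) ?v' @ p @ [-1]) (twin l)"
        using follows_node_prime_twin[OF nd step.prems(1)] unfolding node_prime_child .
      ultimately have "twin l < z" by (intro rep_lex[of "Suc m" "Suc (Suc m)"]) auto
      then show ?thesis using step.prems(3) by simp
    qed
  qed
qed

text \<open>Along \<open>v'\<close> the points \<open>w\<close> just after the digit -2 closing \<open>p\<close> satisfy
  \<open>w\<^sub>j\<^sub>+\<^sub>1 = run v w\<^sub>j - t\<close>. They stay in an interval on which \<open>run v x - x - t\<close> is bounded away
  from 0, so \<open>v'\<close> can be followed only finitely often.\<close>

lemma not_follows_forever:
  assumes nd: "node u p" and l: "follows l (node_word u p) l" and Y: "run (node_word u p) l < twin l"
  shows "\<exists>j. \<not> follows l (rep j (node_prime u p)) (run (node_word u p) l)"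
proof (rule ccontr)
  define y where "y = run (node_word u p) l"
  assume "\<not> ?thesis"
  then have follows: "follows l (rep j (node_prime u p)) y" for j unfolding y_def by blast
  have ly: "l \<le> y" unfolding y_def using l by (simp add: follows_run)
  define w where "w j = run (rep j (node_prime u p) @ p @ [-2]) y" for j
  have split: "rep (Suc j) (node_prime u p) = (rep j (node_prime u p) @ p @ [-2]) @ u" for j
    using rep_comm[of j "node_prime u p"] by (simp add: node_prime_def)
  have split2: "rep (Suc (Suc j)) (node_prime u p) = (rep j (node_prime u p) @ p @ [-2]) @ u @ p @ -2 # u" for j
  proof -
    have "rep (Suc (Suc j)) (node_prime u p) = rep (Suc j) (node_prime u p) @ node_prime u p"
      by (simp add: rep_comm)
    then show ?thesis unfolding split by (simp add: node_prime_def)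
  qed
  have w_ge: "l \<le> w j" for j
    using follows[of "Suc j"] ly unfolding split w_def by (intro follows_run) (auto simp only: follows_append)
  have w_neg: "neg (node_word u p) (w j)" for j
    using follows[of "Suc (Suc j)", THEN follows_imp_neg]
    unfolding split2 node_word_def w_def by (auto simp: neg_append)
  have w_Suc: "w (Suc j) = run (node_word u p) (w j) - t" for j
  proof -
    have "w (Suc j) = run (u @ p @ [-2]) (w j)"
      unfolding w_def split by simp
    also have "\<dots> = run (node_word u p) (w j) - t"
      by (simp add: node_word_def branch_shift)
    finally show ?thesis .
  qed
  have w1: "w 1 < w 0"
  proof -
    have "neg (p @ [-2]) y"
      using follows[of 1, THEN follows_imp_neg] by (auto simp: node_prime_def neg_append)
    moreover have "run (node_prime u p) y < y"
      using run_node_prime_bounds(2)[OF nd l ly] follows[of 1] Y by (simp add: y_def)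
    ultimately show ?thesis
      using run_strict_mono[of "p @ [-2]" y "run (node_prime u p) y"] by (simp add: w_def)
  qed
  let ?v = "node_word u p"
  have neg_l: "neg ?v l" using l by (rule follows_imp_neg)
  \<comment> \<open>Both values are positive: at \<open>l\<close> because \<open>v\<close> is
    followed there, at \<open>w 0\<close> because the sequence drops in its first step. Concavity
    extends the bound to the points between.\<close>
  define d where "d = min (zeta_poly ?v l) (zeta_poly ?v (w 0))"
  have d: "0 < d"
  proof -
    have "run ?v l < l + t" using l by (intro follows_run_less) (auto simp: node_word_def)
    moreover have "run ?v (w 0) < w 0 + t" using w_Suc[of 0] w1 by simp
    ultimately show ?thesis using zeta_poly_pos_iff[OF neg_l] zeta_poly_pos_iff[OF w_neg] by (simp add: d_def)
  qed
  have den_l: "0 < den ?v l" using neg_l by (rule den_pos)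
  have decr: "w (Suc j) \<le> w j - d / den ?v l" if "w j \<le> w 0" for j
  proof -
    have "(w 0 - w j) * zeta_poly ?v l + (w j - l) * zeta_poly ?v (w 0) \<le> (w 0 - l) * zeta_poly ?v (w j)"
      unfolding zeta_poly_quadratic using w_ge that branch_mat_21_nonpos[OF neg_l] by (intro concave_quadratic) auto
    moreover have "(w 0 - w j) * d + (w j - l) * d \<le> (w 0 - w j) * zeta_poly ?v l + (w j - l) * zeta_poly ?v (w 0)"
      using w_ge[of j] that by (intro add_mono mult_left_mono) (auto simp: d_def)
    ultimately have "(w 0 - l) * d \<le> (w 0 - l) * zeta_poly ?v (w j)" by (simp add: algebra_simps)
    then have zeta_poly: "d \<le> zeta_poly ?v (w j)"
      using w1 w_ge[of 1] by (simp add: mult_le_cancel_left)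
    have "den ?v (w j) \<le> den ?v l"
      using w_ge[of j] branch_mat_21_nonpos[OF neg_l] by (simp add: den_def mult_left_mono_neg)
    then have "d / den ?v l \<le> d / den ?v (w j)"
      using d den_pos[OF w_neg[of j]] by (intro divide_left_mono) auto
    also have "\<dots> \<le> zeta_poly ?v (w j) / den ?v (w j)"
      using zeta_poly den_pos[OF w_neg[of j]] by (simp add: divide_right_mono)
    also have "\<dots> = w j - w (Suc j)"
      using den_pos[OF w_neg[of j]] by (simp add: zeta_poly_factor[OF w_neg] w_Suc)
    finally show ?thesis by simp
  qed
  define e where "e = d / den ?v l"
  have e: "0 < e" using d den_l by (simp add: e_def)
  have bound: "w j \<le> w 0 - real j * e" for j
  proof (induction j)
    case (Suc j)
    have "0 \<le> real j * e" using e by simp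
    then have "w j \<le> w 0" using Suc.IH by linarith
    then show ?case using decr[of j, folded e_def] Suc.IH by (simp add: algebra_simps)
  qed simp
  obtain j where "w 0 - l < real j * e" using reals_Archimedean3[OF e] by blast
  then show False using bound[of j] w_ge[of j] by linarith
qed

lemma ex_child:
  assumes nd: "node u p" and l: "follows l (node_word u p) l" and Y: "run (node_word u p) l < twin l"
  shows "\<exists>m. follows l (node_word (node_word u p) (rep m (node_prime u p) @ p)) l"
proof -
  obtain j where j: "\<not> follows l (rep j (node_prime u p)) (run (node_word u p) l)"
    using not_follows_forever[OF assms] by blast
  have "\<exists>i<j. follows l (rep i (node_prime u p) @ p @ [-1]) (run (node_word u p) l)"
    using follows_chain[OF nd l Y dichotomy[OF nd l] run_u_le_run_node_word[OF nd l] Y, of j] j by blast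
  then show ?thesis using l by (auto simp: follows_node_word_child)
qed

lemma child_unique:
  assumes "follows l (node_word (node_word u p) (rep i (node_prime u p) @ p)) x" "follows l (node_word (node_word u p) (rep j (node_prime u p) @ p)) x"
  shows "i = j"
proof -
  have "\<not> a < b" if "follows l (node_word (node_word u p) (rep a (node_prime u p) @ p)) x"
    "follows l (node_word (node_word u p) (rep b (node_prime u p) @ p)) x" for a b
    using rep_lex[of a b l u p "run (node_word u p) x" "run (node_word u p) x"] that
    by (auto simp: follows_node_word_child follows_append)
  then show ?thesis using assms by (meson linorder_neqE_nat)
qed

end

lemma node_word_ones_imp:
  assumes "node u p" "set (node_word u p) \<subseteq> {-1}" shows "p = []"
proof -
  obtain w where "node_word u p = -1 # w" "node_prime u p = -2 # w" using assms(1) by (rule node_tl)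
  then show ?thesis using assms(2) by (cases p) (auto simp: node_word_def node_prime_def)
qed

lemma append_eq_replicate: "v @ x = replicate c a \<Longrightarrow> v = replicate (length v) a"
proof (induction v arbitrary: c)
  case (Cons b v)
  then show ?case by (cases c) auto
qed simp

context branch_maps
begin

section \<open>Parameter intervals\<close>

text \<open>The point 1 - t is - s 2 / s 1 with s j = sin (j \<theta>), and digit -1 maps - s (j +
  1) / s j to - s (j + 2) / s (j + 1). Points left of 1 - t stay left of this orbit, which arrives
  at 0 after n - 2 steps, as s n = 0.\<close>

lemma escape:
  assumes "x < 1 - t" "j \<le> n - 2"
  shows "neg (replicate j (-1)) x \<and> run (replicate j (-1)) x < 0"
proof -
  define \<theta> where "\<theta> = pi / real n"
  define s where "s j = sin (real j * \<theta>)" for j :: nat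
  have t: "t = 1 + 2 * cos \<theta>" by (simp add: t_eq tpar_def \<theta>_def)
  have n\<theta>: "real n * \<theta> = pi" using n3 by (simp add: \<theta>_def)
  have \<theta>: "0 < \<theta>" using n3 by (simp add: \<theta>_def)
  have s_pos: "0 < s j" if "0 < j" "j < n" for j
  proof -
    have "real j * \<theta> < real n * \<theta>" using that \<theta> by (intro mult_strict_right_mono) auto
    then show ?thesis unfolding s_def using that \<theta> n\<theta> by (intro sin_gt_zero) auto
  qed
  have s_nonneg: "0 \<le> s j" if "0 < j" "j \<le> n" for j
    using s_pos[of j] that n\<theta> by (cases "j = n") (auto simp: s_def)
  have rec: "s (Suc (Suc j)) = (t - 1) * s (Suc j) - s j" for j
    using sin_times_cos[of "real (Suc j) * \<theta>" \<theta>] by (simp add: s_def t algebra_simps)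
  have "neg (replicate j (-1)) x \<and> run (replicate j (-1)) x * s (Suc j) < - s (Suc (Suc j))
      \<and> run (replicate j (-1)) x < 0"
    using assms(2)
  proof (induction j)
    case 0
    have "x * s 1 < (1 - t) * s 1"
      using assms(1) s_pos[of 1] n3 by (intro mult_strict_right_mono) auto
    moreover have "s 0 = 0" by (simp add: s_def)
    ultimately show ?case using assms(1) t_ge_2 rec[of 0] by (simp add: algebra_simps)
  next
    case (Suc j)
    define y where "y = run (replicate j (-1)) x"
    have y: "neg (replicate j (-1)) x" "y * s (Suc j) < - s (Suc (Suc j))" "y < 0"
      using Suc by (auto simp: y_def)
    have snoc: "replicate (Suc j) (-1 :: int) = replicate j (-1) @ [-1]"
      by (simp add: replicate_append_same)
    have "- s (Suc (Suc j)) / y < s (Suc j)"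
      unfolding neg_divide_less_eq[OF y(3)] using y(2) by (simp add: mult.commute)
    moreover have "branch (-1) y * s (Suc (Suc j)) = - (t - 1) * s (Suc (Suc j)) - s (Suc (Suc j)) / y"
      by (simp add: branch_def algebra_simps)
    ultimately have less: "branch (-1) y * s (Suc (Suc j)) < - s (Suc (Suc (Suc j)))"
      using rec[of "Suc j"] by (simp add: algebra_simps)
    have "0 \<le> s (Suc (Suc (Suc j)))" "0 < s (Suc (Suc j))"
      using Suc.prems n3 by (auto intro!: s_pos s_nonneg)
    then have "branch (-1) y < 0"
      using less by (smt (verit) mult_nonneg_nonneg)
    then show ?case unfolding snoc using y less by (simp add: neg_append y_def del: fold_replicate)
  qed
  then show ?thesis by simp
qed

text \<open>The negative root of - 1 / (x - 1) = x + t, the equation that defines gamma.\<close>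

definition gamma_pt :: real where
  "gamma_pt = - (t - 1 + sqrt ((t - 1)\<^sup>2 + 4 * (t - 1))) / 2"

lemma gamma_pt_root: "gamma_pt\<^sup>2 + (t - 1) * gamma_pt - (t - 1) = 0"
proof -
  have "(sqrt ((t - 1)\<^sup>2 + 4 * (t - 1)))\<^sup>2 = (t - 1)\<^sup>2 + 4 * (t - 1)"
    using t_ge_2 by (intro real_sqrt_pow2) auto
  then show ?thesis unfolding gamma_pt_def by (simp add: power2_eq_square field_simps)
qed

lemma gamma_pt_unique:
  assumes "x\<^sup>2 + (t - 1) * x - (t - 1) = 0" "x \<le> 0" shows "x = gamma_pt"
proof -
  have "(x - gamma_pt) * (x + gamma_pt + (t - 1)) = 0"
    using assms(1) gamma_pt_root by (simp add: power2_eq_square algebra_simps)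
  moreover have "x + gamma_pt + (t - 1) < 0"
  proof -
    have "0 < sqrt ((t - 1)\<^sup>2 + 4 * (t - 1)) - (t - 1)"
      using t_ge_2 by (auto intro!: real_less_rsqrt)
    then show ?thesis using assms(2) by (simp add: gamma_pt_def field_simps)
  qed
  ultimately show ?thesis by auto
qed

lemma gamma_pt_bounds: "- t < gamma_pt" "gamma_pt < 1 - t"
proof -
  have "sqrt ((t - 1)\<^sup>2 + 4 * (t - 1)) < t + 1"
    using t_ge_2 by (intro real_less_lsqrt) (auto simp: power2_eq_square algebra_simps)
  then show "- t < gamma_pt" by (simp add: gamma_pt_def field_simps)
  have "t - 1 < sqrt ((t - 1)\<^sup>2 + 4 * (t - 1))"
    using t_ge_2 by (auto intro!: real_less_rsqrt)
  then show "gamma_pt < 1 - t" by (simp add: gamma_pt_def field_simps)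
qed

lemma gamma_pt_neg: "gamma_pt < 0" using gamma_pt_bounds t_ge_2 by simp

text \<open>The counterpart of \<open>cylinder\<close> in the coordinate
  \<open>ell0 n \<alpha>\<close>: having only digits -1 means being a single letter.\<close>

definition params :: "int list \<Rightarrow> real set" where
  "params w = {x. - t \<le> x \<and> x < 0 \<and> follows x w x \<and> (set w \<subseteq> {-1} \<longrightarrow> gamma_pt \<le> x)}"

text \<open>Digit forms of the words admitted by \<open>Vcheck n\<close>; \<open>n - 2\<close> is admissible but not extendable.\<close>

definition extendable :: "int list \<Rightarrow> bool" where
  "extendable w \<longleftrightarrow> (\<exists>c. 1 \<le> c \<and> c \<le> n - 3 \<and>
    (w = replicate c (-1) \<or> (\<exists>r. w = replicate c (-1) @ -2 # r)))"

definition admissible :: "int list \<Rightarrow> bool" where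
  "admissible w \<longleftrightarrow> extendable w \<or> w = replicate (n - 2) (-1)"

lemma admissible_prefix:
  assumes "admissible (v @ x)" "v \<noteq> []" "x \<noteq> []" shows "extendable v"
proof -
  have pre: "\<exists>c'. v = replicate c' (-1) \<and> 1 \<le> c' \<and> c' < c" if "v @ x = replicate c (-1 :: int)" for c
  proof -
    have "v = replicate (length v) (-1)"
      using that by (rule append_eq_replicate)
    moreover have "length v < c" using arg_cong[OF that, of length] assms(3) by (cases x) auto
    moreover have "1 \<le> length v" using assms(2) by (simp add: Suc_le_eq)
    ultimately show ?thesis by blast
  qed
  consider c where "c \<le> n - 2" "v @ x = replicate c (-1)"
    | c r where "1 \<le> c" "c \<le> n - 3" "v @ x = replicate c (-1) @ -2 # r"
  proof -
    have "c \<le> n - 2" if "c \<le> n - 3" for c using that by simp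
    then show thesis using assms(1) that unfolding admissible_def extendable_def by auto
  qed
  then show ?thesis
  proof cases
    case 1
    obtain c' where "v = replicate c' (-1)" "1 \<le> c'" "c' < c" using pre[OF 1(2)] by blast
    then show ?thesis using 1(1) unfolding extendable_def by (intro exI[of _ c']) auto
  next
    case 2
    from 2(3) consider us where "v = replicate c (-1) @ us" "us @ x = -2 # r"
      | us where "v @ us = replicate c (-1)" "x = us @ -2 # r"
      unfolding append_eq_append_conv2 by blast
    then show ?thesis
    proof cases
      case 1
      then show ?thesis using 2 unfolding extendable_def by (cases us) auto
    next
      case us: 2
      have "v = replicate (length v) (-1)"
        using us(1) by (rule append_eq_replicate)
      moreover have "length v \<le> c" using arg_cong[OF us(1), of length] by simp
      moreover have "1 \<le> length v" using assms(2) by (simp add: Suc_le_eq)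
      ultimately show ?thesis using 2 unfolding extendable_def by (intro exI[of _ "length v"]) auto
    qed
  qed
qed

text \<open>Left of gamma, hence left of 1 - t, \<open>escape\<close> keeps the orbit negative for
  one -1 more than the initial run. The digit -2 in place of that last -1 then lands below
  -t.\<close>

lemma extendable_gamma_pt_le:
  assumes "extendable w" "\<not> set w \<subseteq> {-1}" "follows x w x" "- t \<le> x"
  shows "gamma_pt \<le> x"
proof (rule ccontr)
  assume "\<not> gamma_pt \<le> x"
  then have x: "x < 1 - t" using gamma_pt_bounds by simp
  obtain c r where c: "c \<le> n - 3" "w = replicate c (-1) @ -2 # r"
    using assms(1,2) unfolding extendable_def by auto
  have "Suc c \<le> n - 2" using c n3 by auto
  then have "run (replicate (Suc c) (-1)) x < 0" using escape[OF x] by blast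
  then have "branch (-1) (run (replicate c (-1)) x) < 0"
    by (simp add: replicate_append_same[symmetric] del: replicate_Suc)
  moreover have "x \<le> branch (-2) (run (replicate c (-1)) x)" using assms(3) by (simp add: c follows_append)
  ultimately show False using assms(4) branch_shift[of "run (replicate c (-1)) x"] by linarith
qed

lemma branch_one_twin:
  assumes "x < 0" shows "0 < branch (-1) (twin x)"
proof -
  have "branch (-1) (twin x) = 1 - 1 / x"
    using branch_shift[of "twin x"] branch_twin[OF assms] by (simp add: branch_def)
  moreover have "1 / x < 0" using assms by simp
  ultimately show ?thesis by linarith
qed

text \<open>One more digit -1 sends \<open>twin x\<close> to the positive number 1 - 1 / x, whereas
  by \<open>escape\<close> it sends the left side to a negative number.\<close>

lemma ones_less_twin:
  assumes "x < 0" "z < 1 - t" "c \<le> n - 3"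
  shows "run (replicate c (-1)) z < twin x"
proof (rule ccontr)
  assume *: "\<not> ?thesis"
  have "Suc c \<le> n - 2" "c \<le> n - 2" using assms n3 by auto
  then have neg: "run (replicate c (-1)) z < 0" "run (replicate (Suc c) (-1)) z < 0"
    using escape[OF assms(2)] by blast+
  then have "branch (-1) (run (replicate c (-1)) z) < 0"
    by (simp add: replicate_append_same[symmetric] del: replicate_Suc)
  moreover have "branch (-1) (twin x) \<le> branch (-1) (run (replicate c (-1)) z)"
    using * neg by (intro branch_mono) auto
  ultimately show False using branch_one_twin[OF assms(1)] by simp
qed

text \<open>At the left end of its interval a word with more than one letter takes the same value as
  its parent.\<close>

definition param_interval :: "int list \<Rightarrow> int list \<Rightarrow> real \<Rightarrow> real \<Rightarrow> bool" where
  "param_interval u p lo ze \<longleftrightarrow> - t < lo \<and> lo < ze \<and> ze < 0 \<and> params (node_word u p) = {lo..<ze} \<and>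
    neg (node_word u p) ze \<and> run (node_word u p) ze = ze + t \<and>
    (set (node_word u p) \<subseteq> {-1} \<and> lo = gamma_pt \<or> run (node_word u p) lo = run u lo)"

lemma param_interval_follows: "param_interval u p lo ze \<Longrightarrow> lo \<le> x \<Longrightarrow> x < ze \<Longrightarrow> follows x (node_word u p) x"
proof -
  assume "param_interval u p lo ze" "lo \<le> x" "x < ze"
  then have "x \<in> params (node_word u p)" by (simp add: param_interval_def)
  then show ?thesis by (simp add: params_def)
qed

lemma param_interval_lo_less_twin:
  assumes nd: "node u p" and inn: "extendable (node_word u p)" and i: "param_interval u p lo ze"
  shows "run (node_word u p) lo < twin lo"
proof -
  have "lo < ze" using i by (simp add: param_interval_def)
  then have "follows lo (node_word u p) lo" by (intro param_interval_follows[OF i]) auto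
  note less = run_u_less_twin[OF nd this]
  have "set (node_word u p) \<subseteq> {-1} \<and> lo = gamma_pt \<or> run (node_word u p) lo = run u lo"
    using i unfolding param_interval_def by blast
  then show ?thesis
  proof
    assume 1: "set (node_word u p) \<subseteq> {-1} \<and> lo = gamma_pt"
    obtain c where c: "c \<le> n - 3" "node_word u p = replicate c (-1) \<or> (\<exists>r. node_word u p = replicate c (-1) @ -2 # r)"
      using inn unfolding extendable_def by blast
    have "node_word u p = replicate c (-1)" using c(2) 1 by auto
    then show ?thesis using 1 ones_less_twin[OF gamma_pt_neg gamma_pt_bounds(2) c(1)] by simp
  qed (use less in simp)
qed

text \<open>At \<open>lo\<close> the image is below \<open>twin\<close>; at \<open>ze\<close> it is
  \<open>ze + t\<close>, positive and so above. The crossing will be the left end of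
  \<open>Jint\<close>.\<close>

lemma param_interval_eta:
  assumes nd: "node u p" and inn: "extendable (node_word u p)" and i: "param_interval u p lo ze"
  obtains et where "lo < et" "et < ze" "eta_poly (node_word u p) et = 0"
    "\<And>x. lo \<le> x \<Longrightarrow> x < et \<Longrightarrow> run (node_word u p) x < twin x"
    "\<And>x. et \<le> x \<Longrightarrow> x < ze \<Longrightarrow> twin x \<le> run (node_word u p) x"
proof -
  have lo: "lo < ze" "ze < 0" "lo < 0" "neg (node_word u p) ze" "run (node_word u p) ze = ze + t" "- t < lo"
    using i by (auto simp: param_interval_def)
  have neg: "neg (node_word u p) x" if "x \<le> ze" for x using lo(4) that by (rule neg_mono)
  have l: "run (node_word u p) lo < twin lo" using assms by (rule param_interval_lo_less_twin)
  then have 1: "0 < eta_poly (node_word u p) lo" using eta_poly_pos_iff[OF neg] lo by simp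
  have "twin ze < run (node_word u p) ze" using lo twin_neg[of ze] by simp
  then have 2: "eta_poly (node_word u p) ze \<le> 0" "eta_poly (node_word u p) ze \<noteq> 0"
    using eta_poly_pos_iff[OF lo(4,2)] eta_poly_zero_iff[OF lo(4,2)] by auto
  have "run (node_word u p) lo < 0" using l twin_neg[OF lo(3)] by simp
  moreover have "node_word u p \<noteq> []" by (simp add: node_word_def)
  ultimately show ?thesis
  proof (rule eta_poly_crossing[OF neg[OF less_imp_le[OF lo(1)]] _ _ 1 2(1) lo(1,2)])
    fix et
    assume et: "lo < et" "et \<le> ze" "eta_poly (node_word u p) et = 0"
      and pos: "\<And>x. lo \<le> x \<Longrightarrow> x < et \<Longrightarrow> 0 < eta_poly (node_word u p) x"
      and neg': "\<And>x. et < x \<Longrightarrow> x \<le> 0 \<Longrightarrow> eta_poly (node_word u p) x < 0"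
    have "et \<noteq> ze" using et(3) 2 by auto
    show ?thesis
    proof (rule that)
      show "lo < et" "eta_poly (node_word u p) et = 0" by fact+
      show "et < ze" using et(2) \<open>et \<noteq> ze\<close> by simp
      show "run (node_word u p) x < twin x" if "lo \<le> x" "x < et" for x
        using et(2) pos[OF that] that lo eta_poly_pos_iff[OF neg[of x]] by simp
      show "twin x \<le> run (node_word u p) x" if "et \<le> x" "x < ze" for x
      proof -
        have "eta_poly (node_word u p) x \<le> 0" using et(3) neg'[of x] that lo by (cases "x = et") auto
        then show ?thesis using that lo eta_poly_pos_iff[OF neg[of x]] by simp
      qed
    qed
  qed
qed

end

lemma rep_Suc_right: "rep (Suc m) w = rep m w @ w"
  by (simp add: rep_comm)

context branch_maps
begin

section \<open>Splitting the interval of a word among its children\<close>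

lemma neg_node_prime_imp: "neg (node_prime u p) z \<Longrightarrow> neg (p @ [-1]) z"
  by (simp add: node_prime_def neg_append)

lemma follows_node_prime_ge: "follows l (node_prime u p) z \<Longrightarrow> l + t \<le> run (p @ [-1]) z"
  using branch_shift[of "run p z"] by (auto simp: node_prime_def follows_append)

lemma child_bounds:
  assumes nd: "node u p" and f: "follows x (node_word u p @ rep m (node_prime u p)) x"
    and less: "run (node_word u p) x < twin x"
  shows "run u x \<le> run (node_word u p @ rep m (node_prime u p)) x" "run (node_word u p @ rep m (node_prime u p)) x < twin x"
proof -
  have l: "follows x (node_word u p) x" and fr: "follows x (rep m (node_prime u p)) (run (node_word u p) x)"
    using f by (auto simp: follows_append)
  have "\<not> (\<exists>i<m. follows x (rep i (node_prime u p) @ p @ [-1]) (run (node_word u p) x))"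
    using rep_lex[OF _ _ fr] by blast
  with follows_chain[OF nd l less dichotomy[OF nd l] run_u_le_run_node_word[OF nd l] less, of m]
  show "run u x \<le> run (node_word u p @ rep m (node_prime u p)) x" "run (node_word u p @ rep m (node_prime u p)) x < twin x"
    by auto
qed

text \<open>After \<open>m\<close> copies of \<open>v'\<close> either the closing suffix or another
  \<open>v'\<close> is followed. The image under \<open>p (-1)\<close> tells which: it is below
  \<open>x + t\<close> in the first case and not in the second, and the sign of
  \<open>zeta_poly\<close> records this.\<close>

lemma child_alternative:
  assumes nd: "node u p" and f: "follows x (node_word u p @ rep m (node_prime u p)) x"
    and less: "run (node_word u p) x < twin x"
  defines "w \<equiv> node_word u p @ rep m (node_prime u p) @ p @ [-1]"
  shows "neg w x" "follows x w x \<longleftrightarrow> 0 < zeta_poly w x"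
    "follows x (node_word u p @ rep (Suc m) (node_prime u p)) x \<longleftrightarrow> \<not> 0 < zeta_poly w x"
proof -
  define y where "y = run (node_word u p @ rep m (node_prime u p)) x"
  have l: "follows x (node_word u p) x" using f by (simp add: follows_append)
  have y: "run u x \<le> y" "y < twin x" using child_bounds[OF nd f less] by (simp_all add: y_def)
  have dich: "follows x (p @ [-1]) y \<or> follows x (node_prime u p) y" using dichotomy[OF nd l y] .
  have w: "w = (node_word u p @ rep m (node_prime u p)) @ p @ [-1]" by (simp add: w_def)
  have neg_y: "neg (p @ [-1]) y" using dich by (auto dest: follows_imp_neg neg_node_prime_imp)
  then show neg: "neg w x" using follows_imp_neg[OF f] unfolding w neg_append[of "node_word u p @ _"] y_def by blast
  have fw: "follows x w x \<longleftrightarrow> follows x (p @ [-1]) y"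
    using f unfolding w follows_append[of x "node_word u p @ _"] y_def by blast
  have fv: "follows x (node_word u p @ rep (Suc m) (node_prime u p)) x \<longleftrightarrow> follows x (node_prime u p) y"
    unfolding rep_Suc_right append_assoc[symmetric] using f follows_append[of x "node_word u p @ rep m (node_prime u p)" "node_prime u p"]
    by (simp add: y_def)
  have zeta_poly: "0 < zeta_poly w x \<longleftrightarrow> run (p @ [-1]) y < x + t"
    unfolding zeta_poly_pos_iff[OF neg] by (simp add: w y_def)
  have "run (p @ [-1]) y < x + t" if "follows x (p @ [-1]) y"
    using follows_run_less[OF that] by simp
  moreover have "x + t \<le> run (p @ [-1]) y" if "follows x (node_prime u p) y"
    using that by (rule follows_node_prime_ge)
  ultimately show "follows x w x \<longleftrightarrow> 0 < zeta_poly w x"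
    "follows x (node_word u p @ rep (Suc m) (node_prime u p)) x \<longleftrightarrow> \<not> 0 < zeta_poly w x"
    unfolding fw fv zeta_poly using dich by (meson not_less)+
qed

lemma run_rep_fixed: "run w x = x \<Longrightarrow> run (rep m w) x = x"
  by (induction m) auto

lemma follows_rep_fixed: "follows l w x \<Longrightarrow> run w x = x \<Longrightarrow> follows l (rep m w) x"
  by (induction m) (auto simp: follows_append)

text \<open>At \<open>et\<close> the point \<open>twin et\<close> is fixed by \<open>v'\<close>, so
  all copies of \<open>v'\<close> are followed and the closing suffix overshoots
  \<open>et + t\<close>. At \<open>e\<close> it does not overshoot, and the single crossing
  \<open>e'\<close> separates child \<open>m\<close> from the parameters that go on with
  \<open>v'\<close>.\<close>

lemma child_step:
  assumes nd: "node u p"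
    and follows_et: "follows et (node_word u p) et" and et: "run (node_word u p) et = twin et"
    and less: "\<And>x. e \<le> x \<Longrightarrow> x < et \<Longrightarrow> run (node_word u p) x < twin x"
    and e: "e < et" "et < 0"
    and f: "\<And>x. e \<le> x \<Longrightarrow> x < et \<Longrightarrow> follows x (node_word u p @ rep m (node_prime u p)) x"
    and start: "run (node_word u p @ rep m (node_prime u p) @ p @ [-1]) e < e + t"
  obtains e' where "e < e'" "e' < et"
    "neg (node_word u p @ rep m (node_prime u p) @ p @ [-1]) e'"
    "run (node_word u p @ rep m (node_prime u p) @ p @ [-1]) e' = e' + t"
    "\<And>x. e \<le> x \<Longrightarrow> x < et \<Longrightarrow> follows x (node_word u p @ rep m (node_prime u p) @ p @ [-1]) x \<longleftrightarrow> x < e'"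
    "\<And>x. e \<le> x \<Longrightarrow> x < et \<Longrightarrow> follows x (node_word u p @ rep (Suc m) (node_prime u p)) x \<longleftrightarrow> e' \<le> x"
    "run (node_word u p @ rep (Suc m) (node_prime u p)) e' = run u e'"
proof -
  define w where "w = node_word u p @ rep m (node_prime u p) @ p @ [-1]"
  have w: "w = (node_word u p @ rep m (node_prime u p)) @ p @ [-1]" by (simp add: w_def)
  have twin_fixed: "run (node_prime u p) (twin et) = twin et" using run_node_prime_twin[OF nd e(2)] et by simp
  have follows_twin: "follows et (node_prime u p) (twin et)" using follows_node_prime_twin[OF nd follows_et] .
  have y_et: "run (node_word u p @ rep m (node_prime u p)) et = twin et"
    using run_rep_fixed[OF twin_fixed] et by simp
  have "neg (node_word u p @ rep m (node_prime u p)) et"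
    using follows_imp_neg[OF follows_et] follows_imp_neg[OF follows_rep_fixed[OF follows_twin twin_fixed]] et
    by (simp add: neg_append)
  then have neg_et: "neg w et"
    unfolding w neg_append[of "node_word u p @ _"] y_et using neg_node_prime_imp[OF follows_imp_neg[OF follows_twin]] by blast
  have run_et: "run w et = run (p @ [-1]) (twin et)"
    unfolding w using y_et by simp
  \<comment> \<open>Equality would let the final -2 hit \<open>et\<close> itself, so
    \<open>u\<close> would map \<open>et\<close> to \<open>twin et\<close>.\<close>
  have "run w et \<noteq> et + t"
  proof
    assume "run w et = et + t"
    then have "branch (-2) (run p (twin et)) = et" using branch_shift run_et by simp
    then have "twin et = run u et" using twin_fixed by (simp add: node_prime_def)
    then show False using run_u_less_twin[OF nd follows_et] by simp
  qed
  then have zeta_poly_et: "zeta_poly w et \<le> 0" "zeta_poly w et \<noteq> 0"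
    using follows_node_prime_ge[OF follows_twin] run_et zeta_poly_pos_iff[OF neg_et] zeta_poly_zero_iff[OF neg_et] by auto
  have neg_e: "neg w e" using neg_mono[OF neg_et] e by simp
  have "0 < zeta_poly w e" using start zeta_poly_pos_iff[OF neg_e] by (simp add: w_def)
  then show ?thesis
  proof (rule zeta_poly_crossing[OF neg_et _ zeta_poly_et(1) e(1)])
    fix e'
    assume e': "e < e'" "e' \<le> et" "zeta_poly w e' = 0"
      and pos: "\<And>x. e \<le> x \<Longrightarrow> x < e' \<Longrightarrow> 0 < zeta_poly w x"
      and neg': "\<And>x. e' < x \<Longrightarrow> zeta_poly w x < 0"
    have less_et: "e' < et" using e' zeta_poly_et by (cases "e' = et") auto
    have neg_e': "neg w e'" using neg_mono[OF neg_et e'(2)] .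
    have run_e': "run w e' = e' + t" using e'(3) zeta_poly_zero_iff[OF neg_e'] by simp
    have zeta_poly_iff: "0 < zeta_poly w x \<longleftrightarrow> x < e'" if "e \<le> x" for x
      using pos[OF that] neg'[of x] e'(3) by (cases x e' rule: linorder_cases) auto
    show ?thesis
    proof (rule that)
      show "e < e'" "e' < et" by fact+
      show "neg (node_word u p @ rep m (node_prime u p) @ p @ [-1]) e'" using neg_e' by (simp add: w_def)
      show "run (node_word u p @ rep m (node_prime u p) @ p @ [-1]) e' = e' + t" using run_e' by (simp add: w_def)
      show "follows x (node_word u p @ rep m (node_prime u p) @ p @ [-1]) x \<longleftrightarrow> x < e'" if "e \<le> x" "x < et" for x
        using child_alternative(2)[OF nd f[OF that] less[OF that]] zeta_poly_iff[OF that(1)]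
        by (simp add: w_def)
      show "follows x (node_word u p @ rep (Suc m) (node_prime u p)) x \<longleftrightarrow> e' \<le> x" if "e \<le> x" "x < et" for x
        unfolding child_alternative(3)[OF nd f[OF that] less[OF that], folded w_def]
          zeta_poly_iff[OF that(1)] by (rule not_less)
      \<comment> \<open>At \<open>e'\<close> the closing suffix hits the excluded right end; with -2
        as last digit it returns to \<open>e'\<close> instead, and the rest of \<open>v'\<close> is
        \<open>u\<close>.\<close>
      have "branch (-2) (run p (run (node_word u p @ rep m (node_prime u p)) e')) = e'"
        using run_e' branch_shift[of "run p (run (node_word u p @ rep m (node_prime u p)) e')"] by (simp add: w)
      then have "run (node_prime u p) (run (node_word u p @ rep m (node_prime u p)) e') = run u e'"
        by (simp add: node_prime_def)
      then show "run (node_word u p @ rep (Suc m) (node_prime u p)) e' = run u e'"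
        unfolding rep_Suc_right append_assoc[symmetric] fold_append[of branch "node_word u p @ rep m (node_prime u p)"] by simp
    qed
  qed
qed

text \<open>From the value of \<open>u\<close>, the suffix \<open>p (-1)\<close> reaches the value
  of \<open>v\<close>, which is in range. The other possible start is gamma with a single letter,
  where \<open>escape\<close> permits one further -1.\<close>

lemma child_start:
  assumes nd: "node u p" and inn: "extendable (node_word u p)" and f: "follows e (node_word u p) e"
    and "run (node_word u p @ rep m (node_prime u p)) e = run u e \<or> m = 0 \<and> set (node_word u p) \<subseteq> {-1} \<and> e = gamma_pt"
  shows "run (node_word u p @ rep m (node_prime u p) @ p @ [-1]) e < e + t"
  using assms(4)
proof
  assume "run (node_word u p @ rep m (node_prime u p)) e = run u e"
  then have "run (node_word u p @ rep m (node_prime u p) @ p @ [-1]) e = run (node_word u p) e"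
    by (simp add: node_word_def)
  then show ?thesis using follows_run_less[OF f] by (simp add: node_word_def)
next
  assume *: "m = 0 \<and> set (node_word u p) \<subseteq> {-1} \<and> e = gamma_pt"
  obtain c where c: "c \<le> n - 3" "node_word u p = replicate c (-1) \<or> (\<exists>r. node_word u p = replicate c (-1) @ -2 # r)"
    using inn unfolding extendable_def by blast
  have v: "node_word u p = replicate c (-1)" using c(2) * by auto
  have "p = []" using node_word_ones_imp[OF nd] * by blast
  then have w: "node_word u p @ rep m (node_prime u p) @ p @ [-1] = replicate (Suc c) (-1)"
    using * unfolding v by (simp add: replicate_append_same)
  have "Suc c \<le> n - 2" using c(1) n3 by simp
  then have "run (replicate (Suc c) (-1)) gamma_pt < 0" using escape[OF gamma_pt_bounds(2)] by blast
  then show ?thesis unfolding w using * gamma_pt_bounds by simp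
qed

text \<open>Each further copy of \<open>v'\<close> only moves the left end, so the children can be
  lined up from left to right, each between two consecutive left ends.\<close>

lemma param_interval_children:
  assumes nd: "node u p" and inn: "extendable (node_word u p)" and i: "param_interval u p lo ze"
    and et: "lo < et" "et < ze" "eta_poly (node_word u p) et = 0"
      "\<And>x. lo \<le> x \<Longrightarrow> x < et \<Longrightarrow> run (node_word u p) x < twin x"
  shows "\<exists>e. lo \<le> e \<and> e < et \<and>
    (\<forall>x. lo \<le> x \<longrightarrow> x < et \<longrightarrow> (follows x (node_word u p @ rep m (node_prime u p)) x \<longleftrightarrow> e \<le> x)) \<and>
    (run (node_word u p @ rep m (node_prime u p)) e = run u e \<or> m = 0 \<and> set (node_word u p) \<subseteq> {-1} \<and> e = gamma_pt)"
proof (induction m)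
  case 0
  have "follows x (node_word u p) x" if "lo \<le> x" "x < et" for x using param_interval_follows[OF i] that et by simp
  moreover have "set (node_word u p) \<subseteq> {-1} \<and> lo = gamma_pt \<or> run (node_word u p) lo = run u lo"
    using i unfolding param_interval_def by blast
  ultimately show ?case using et by (intro exI[of _ lo]) auto
next
  case (Suc m)
  then obtain e where e: "lo \<le> e" "e < et"
    and iff: "\<And>x. lo \<le> x \<Longrightarrow> x < et \<Longrightarrow> follows x (node_word u p @ rep m (node_prime u p)) x \<longleftrightarrow> e \<le> x"
    and start: "run (node_word u p @ rep m (node_prime u p)) e = run u e \<or> m = 0 \<and> set (node_word u p) \<subseteq> {-1} \<and> e = gamma_pt"
    by blast
  have "ze < 0" using i unfolding param_interval_def by blast
  then have et0: "et < 0" using et by simp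
  have fet: "follows et (node_word u p) et" using param_interval_follows[OF i] et by simp
  have run_et: "run (node_word u p) et = twin et" using eta_poly_zero_iff[OF follows_imp_neg[OF fet] et0] et(3) by simp
  have f: "follows x (node_word u p @ rep m (node_prime u p)) x" if "e \<le> x" "x < et" for x using iff that e by simp
  have less: "run (node_word u p) x < twin x" if "e \<le> x" "x < et" for x using et(4) that e by simp
  have "follows e (node_word u p) e" using f[of e] e by (simp add: follows_append)
  note st = child_start[OF nd inn this start]
  show ?case
  proof (rule child_step[OF nd fet run_et less e(2) et0 f st])
    fix e'
    assume e': "e < e'" "e' < et"
      and iff': "\<And>x. e \<le> x \<Longrightarrow> x < et \<Longrightarrow> follows x (node_word u p @ rep (Suc m) (node_prime u p)) x \<longleftrightarrow> e' \<le> x"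
      and run: "run (node_word u p @ rep (Suc m) (node_prime u p)) e' = run u e'"
    have "follows x (node_word u p @ rep (Suc m) (node_prime u p)) x \<longleftrightarrow> e' \<le> x" if x: "lo \<le> x" "x < et" for x
    proof (cases "e \<le> x")
      case False
      then have "\<not> follows x (node_word u p @ rep m (node_prime u p)) x" using iff[OF x] by simp
      then have "\<not> follows x (node_word u p @ rep (Suc m) (node_prime u p)) x"
        unfolding rep_Suc_right append_assoc[symmetric] follows_append[of x "node_word u p @ rep m (node_prime u p)"] by blast
      then show ?thesis using False e' by simp
    qed (use iff' x in simp)
    then show ?thesis using e e' run by (intro exI[of _ e']) auto
  qed
qed

lemma param_interval_child:
  assumes nd: "node u p" and inn: "extendable (node_word u p)" and i: "param_interval u p lo ze"
    and ad: "admissible (node_word (node_word u p) (rep m (node_prime u p) @ p))"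
  shows "\<exists>lo' ze'. param_interval (node_word u p) (rep m (node_prime u p) @ p) lo' ze'"
proof (rule param_interval_eta[OF nd inn i])
  fix et
  assume et: "lo < et" "et < ze" "eta_poly (node_word u p) et = 0"
    and lt: "\<And>x. lo \<le> x \<Longrightarrow> x < et \<Longrightarrow> run (node_word u p) x < twin x"
    and ge: "\<And>x. et \<le> x \<Longrightarrow> x < ze \<Longrightarrow> twin x \<le> run (node_word u p) x"
  let ?w = "node_word u p @ rep m (node_prime u p) @ p @ [-1]"
  obtain e where e: "lo \<le> e" "e < et"
    and iff: "\<And>x. lo \<le> x \<Longrightarrow> x < et \<Longrightarrow> follows x (node_word u p @ rep m (node_prime u p)) x \<longleftrightarrow> e \<le> x"
    and start: "run (node_word u p @ rep m (node_prime u p)) e = run u e \<or> m = 0 \<and> set (node_word u p) \<subseteq> {-1} \<and> e = gamma_pt"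
    using param_interval_children[OF nd inn i et lt, of m] by blast
  have ze: "ze < 0" "- t < lo" using i unfolding param_interval_def by blast+
  then have et0: "et < 0" using et by simp
  have fet: "follows et (node_word u p) et" using param_interval_follows[OF i] et by simp
  have run_et: "run (node_word u p) et = twin et" using eta_poly_zero_iff[OF follows_imp_neg[OF fet] et0] et(3) by simp
  have f: "follows x (node_word u p @ rep m (node_prime u p)) x" if "e \<le> x" "x < et" for x using iff that e by simp
  have less: "run (node_word u p) x < twin x" if "e \<le> x" "x < et" for x using lt that e by simp
  have fe: "follows e (node_word u p) e" using f[of e] e by (simp add: follows_append)
  note st = child_start[OF nd inn fe start]
  have params_v: "x \<in> params (node_word u p) \<longleftrightarrow> lo \<le> x \<and> x < ze" for x
    using i by (simp add: param_interval_def)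
  show ?thesis
  proof (rule child_step[OF nd fet run_et less e(2) et0 f st])
    fix e'
    assume e': "e < e'" "e' < et" "neg ?w e'" "run ?w e' = e' + t"
      and iff': "\<And>x. e \<le> x \<Longrightarrow> x < et \<Longrightarrow> follows x ?w x \<longleftrightarrow> x < e'"
    have "params ?w = {e..<e'}"
    proof (intro set_eqI iffI)
      fix x assume "x \<in> params ?w"
      then have x: "- t \<le> x" "x < 0" "follows x ?w x" "set ?w \<subseteq> {-1} \<longrightarrow> gamma_pt \<le> x" by (simp_all add: params_def)
      have fv: "follows x (node_word u p) x" "follows x (node_word u p @ rep m (node_prime u p)) x" using x(3) by (auto simp: follows_append)
      \<comment> \<open>A child with several letters carries no gamma condition, but a single-letter
        parent does.\<close>
      have "gamma_pt \<le> x" if "\<not> set ?w \<subseteq> {-1}"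
      proof -
        have "extendable ?w" using ad that unfolding node_word_child admissible_def by fastforce
        then show ?thesis using extendable_gamma_pt_le that x(1,3) by blast
      qed
      then have "x \<in> params (node_word u p)" using x fv by (auto simp: params_def)
      then have lo: "lo \<le> x" "x < ze" by (auto simp: params_v)
      have "run (node_word u p) x < twin x" using child_imp_less_twin[OF nd] x(3) unfolding node_word_child by blast
      then have xet: "x < et" using ge[of x] lo by (meson not_le)
      have "e \<le> x" using iff[OF lo(1) xet] fv by blast
      then show "x \<in> {e..<e'}" using iff' xet x(3) by simp
    next
      fix x assume "x \<in> {e..<e'}"
      then have x: "e \<le> x" "x < e'" by auto
      then have "follows x ?w x" using iff' e' by simp
      moreover have "gamma_pt \<le> x" if "set ?w \<subseteq> {-1}"
      proof -
        have "x \<in> params (node_word u p)" using x e e' et by (simp add: params_v)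
        then show ?thesis using that by (auto simp: params_def)
      qed
      ultimately show "x \<in> params ?w" using x e e' et0 ze by (simp add: params_def)
    qed
    moreover have "set ?w \<subseteq> {-1} \<and> e = gamma_pt \<or> run ?w e = run (node_word u p) e"
      using start
    proof
      assume "run (node_word u p @ rep m (node_prime u p)) e = run u e"
      then show ?thesis by (simp add: node_word_def)
    next
      assume "m = 0 \<and> set (node_word u p) \<subseteq> {-1} \<and> e = gamma_pt"
      then show ?thesis using node_word_ones_imp[OF nd] by auto
    qed
    ultimately have "param_interval (node_word u p) (rep m (node_prime u p) @ p) e e'"
      unfolding param_interval_def node_word_child using e e' et0 ze by auto
    then show ?thesis by blast
  qed
qed

section \<open>Every admissible word has an interval\<close>

lemma admissible_one: "admissible [-1]"
proof (cases "n = 3")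
  case True
  then have "n - 2 = 1" by simp
  then show ?thesis unfolding admissible_def by simp
next
  case False
  then have "1 \<le> n - 3" using n3 by simp
  then show ?thesis unfolding admissible_def extendable_def by (intro disjI1 exI[of _ 1]) simp
qed

lemma zeta_poly_one: "zeta_poly [-1] x = - (x\<^sup>2 + (2 * t - 1) * x + 1)"
  unfolding zeta_poly_def num_def den_def branch_mat_Cons_entries
  by (simp add: mat_def power2_eq_square algebra_simps)

lemma param_interval_base: "\<exists>lo ze. param_interval [] [] lo ze"
proof -
  have node_word: "node_word [] [] = [-1]" by (simp add: node_word_def)
  have "run (replicate 1 (-1)) gamma_pt < 0" using escape[OF gamma_pt_bounds(2), of 1] n3 by simp
  then have "run [-1] gamma_pt < gamma_pt + t" using gamma_pt_bounds by simp
  then have 1: "0 < zeta_poly [-1] gamma_pt" using gamma_pt_neg zeta_poly_pos_iff[of "[-1]" gamma_pt] by simp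
  have 2: "zeta_poly [-1] 0 \<le> 0" by (simp add: zeta_poly_one)
  have neg: "neg [-1] gamma_pt" using gamma_pt_neg by simp
  show ?thesis
  proof (rule zeta_poly_crossing[OF neg 1 2 gamma_pt_neg])
    fix r
    assume r: "gamma_pt < r" "r \<le> 0" "zeta_poly [-1] r = 0"
      and pos: "\<And>x. gamma_pt \<le> x \<Longrightarrow> x < r \<Longrightarrow> 0 < zeta_poly [-1] x"
      and neg': "\<And>x. r < x \<Longrightarrow> zeta_poly [-1] x < 0"
    have "r \<noteq> 0" using r(3) by (auto simp: zeta_poly_one)
    then have r0: "r < 0" using r by simp
    have zeta_poly_iff: "0 < zeta_poly [-1] x \<longleftrightarrow> x < r" if "gamma_pt \<le> x" for x
      using pos[OF that] neg'[of x] r(3) by (cases x r rule: linorder_cases) auto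
    have "x \<in> params [-1] \<longleftrightarrow> gamma_pt \<le> x \<and> x < r" for x
    proof (cases "gamma_pt \<le> x \<and> x < 0")
      case True
      then have x: "gamma_pt \<le> x" "x < 0" "neg [-1] x" by auto
      have "follows x [-1] x \<longleftrightarrow> run [-1] x < x + t"
        using branch_minus_one_greater[OF x(2)] x(2) by auto
      also have "\<dots> \<longleftrightarrow> x < r"
        unfolding zeta_poly_pos_iff[OF x(3), symmetric] by (rule zeta_poly_iff[OF x(1)])
      finally show ?thesis using x gamma_pt_bounds(1) by (simp add: params_def del: follows.simps)
    next
      case False
      then show ?thesis using r0 by (simp add: params_def del: follows.simps) linarith
    qed
    then have "params [-1] = {gamma_pt..<r}" by (simp add: set_eq_iff)
    moreover have "run [-1] r = r + t" using zeta_poly_zero_iff[of "[-1]" r] r(3) r0 by simp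
    ultimately have "param_interval [] [] gamma_pt r"
      unfolding param_interval_def node_word using r r0 gamma_pt_bounds by simp
    then show ?thesis by blast
  qed
qed

lemma node_interval:
  assumes "node u p" "admissible (node_word u p)"
  shows "\<exists>lo ze. param_interval u p lo ze"
  using assms
proof induction
  case base
  then show ?case using param_interval_base by simp
next
  case (step u p m)
  have "extendable (node_word u p)"
    using admissible_prefix[of "node_word u p" "rep m (node_prime u p) @ p @ [-1]"] step.prems
    unfolding node_word_child by (simp add: node_word_def)
  moreover then obtain lo ze where "param_interval u p lo ze" using step.IH by (auto simp: admissible_def)
  ultimately show ?case using param_interval_child step by blast
qed

end

lemma set_rep_subset: "set (rep m w) \<subseteq> set w"
  by (induction m) auto

lemma node_digits: "node u p \<Longrightarrow> set (node_word u p) \<subseteq> {-1, -2}"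
proof (induction rule: node.induct)
  case base
  then show ?case by (simp add: node_word_def)
next
  case (step u p m)
  then have "set (rep m (node_prime u p)) \<subseteq> {-1, -2}"
    using set_rep_subset[of m "node_prime u p"] by (auto simp: node_word_def node_prime_def)
  then show ?case using step by (auto simp: node_word_def)
qed

context branch_maps
begin

text \<open>Monotonicity transports the claim from \<open>lo\<close>: there a proper prefix lands on
  a point to which another digit applies, and the full word lands below
  \<open>twin lo\<close>.\<close>

lemma param_interval_lo_neg:
  assumes nd: "node u p" and inn: "extendable (node_word u p)" and i: "param_interval u p lo ze"
    and v: "node_word u p = b @ e" and z: "z \<le> - t"
  shows "neg b z" "run b z < 0"
proof -
  have lo: "lo < ze" "ze < 0" "- t < lo" "neg (node_word u p) ze" using i unfolding param_interval_def by blast+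
  have neg: "neg (node_word u p) lo" using neg_mono[OF lo(4)] lo(1) by simp
  have r: "run (node_word u p) lo < 0" using param_interval_lo_less_twin[OF nd inn i] twin_neg[of lo] lo by simp
  have b: "neg b lo" using neg by (simp add: v neg_append)
  show "neg b z" using neg_mono[OF b] z lo by simp
  have "run b lo < 0"
  proof (cases e)
    case Nil
    then show ?thesis using r v by simp
  next
    case (Cons k e')
    then show ?thesis using neg by (simp add: v neg_append)
  qed
  moreover have "run b z \<le> run b lo" using run_mono[OF b] z lo by simp
  ultimately show "run b z < 0" by simp
qed

section \<open>Uniqueness of the end points\<close>

text \<open>Whenever a factor of \<open>v\<close> deviates from \<open>v\<close>, it has the digit -2 where \<open>v\<close> has -1, which
  throws a point left of \<open>-t\<close> back to the left of \<open>-t\<close>.\<close>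

lemma factor_less_twin:
  assumes nd: "node u p" and inn: "extendable (node_word u p)" and i: "param_interval u p lo ze"
    and v: "node_word u p = replicate c (-1) @ -2 # r" and c: "c \<le> n - 3"
  shows "node_word u p = a @ b @ e \<Longrightarrow> z \<le> - t \<Longrightarrow> neg b z \<and> run b z < twin (- t)"
proof (induction "length b" arbitrary: a b z rule: less_induct)
  case less
  have t0: "- t < 0" "- t < 1 - t" using t_ge_2 by auto
  have ones: "neg (replicate j (-1)) y \<and> run (replicate j (-1)) y < 0" if "y \<le> - t" "j \<le> Suc c" for j y
    using that c n3 by (intro escape) auto
  \<comment> \<open>Behind this -2 only the shorter factor \<open>b''\<close> remains. As
    \<open>p' (-1)\<close> takes -t, and so \<open>z\<close>, below 0, \<open>p' (-2)\<close> takes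
    \<open>z\<close> below -t, where the induction hypothesis applies.\<close>
  have red: ?case if b: "b = p' @ -2 # b''" and good: "neg (p' @ [-1]) (- t)" "run (p' @ [-1]) (- t) < 0" for p' b''
  proof -
    have g: "neg (p' @ [-1]) z" "run (p' @ [-1]) z < 0"
      using neg_mono[OF good(1) less.prems(2)] run_mono[OF good(1) less.prems(2)] good(2) by auto
    have "neg (p' @ [-2]) z" using g(1) by (simp add: neg_append)
    have "run (p' @ [-2]) z \<le> - t" using g(2) branch_shift[of "run p' z"] by simp
    moreover have "node_word u p = (a @ p' @ [-2]) @ b'' @ e" using less.prems(1) b by simp
    moreover have "length b'' < length b" using b by simp
    ultimately have "neg b'' (run (p' @ [-2]) z) \<and> run b'' (run (p' @ [-2]) z) < twin (- t)"
      using less.hyps[of b'' "a @ p' @ [-2]" "run (p' @ [-2]) z"] by blast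
    then show ?thesis using g(1) by (simp add: b neg_append)
  qed
  have len: "length b \<le> length (node_word u p)" using arg_cong[OF less.prems(1), of length] by simp
  consider "prefix b (node_word u p)" | "strict_prefix (node_word u p) b" | "parallel b (node_word u p)"
    by (rule prefix_cases)
  then show ?case
  proof cases
    case 1
    then obtain e' where "replicate c (-1) @ -2 # r = b @ e'" unfolding v by (auto elim: prefixE)
    then consider us where "replicate c (-1) = b @ us"
      | us where "replicate c (-1) @ us = b" "-2 # r = us @ e'"
      unfolding append_eq_append_conv2 by blast
    then show ?thesis
    proof cases
      case 1
      then have "b = replicate (length b) (-1)" by (rule append_eq_replicate[OF sym])
      moreover have "length b \<le> c" using arg_cong[OF 1, of length] by simp
      ultimately obtain j where j: "b = replicate j (-1)" "j \<le> c" by blast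
      have "z < 1 - t" using less.prems(2) by simp
      moreover have "j \<le> n - 3" using j(2) c by simp
      ultimately show ?thesis unfolding j(1) using ones_less_twin[OF t0(1), of z j] ones[OF less.prems(2), of j] j(2) by simp
    next
      case 2
      show ?thesis
      proof (cases us)
        case Nil
        have "z < 1 - t" using less.prems(2) by simp
        then show ?thesis using 2(1)[symmetric] Nil ones_less_twin[OF t0(1) _ c, of z] ones[OF less.prems(2), of c] by simp
      next
        case (Cons k us')
        then have b: "b = replicate c (-1) @ -2 # us'" using 2 by auto
        have "replicate c (-1) @ [-1] = replicate (Suc c) (-1 :: int)"
          by (simp add: replicate_append_same)
        then show ?thesis using red[OF b] ones[OF order_refl order_refl] by simp
      qed
    qed
  next
    case 2
    then show ?thesis using len prefix_length_less[OF 2] by simp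
  next
    case 3
    from parallel_decomp[OF this] obtain p' x b' y v' where d: "x \<noteq> y" "b = p' @ x # b'" "node_word u p = p' @ y # v'"
      by blast
    have "x \<in> set (node_word u p)" unfolding less.prems(1) d(2) by simp
    moreover have "y \<in> set (node_word u p)" unfolding d(3) by simp
    ultimately have xy: "x = -1 \<and> y = -2 \<or> x = -2 \<and> y = -1" using node_digits[OF nd] d(1) by auto
    have lo: "lo < ze" using i unfolding param_interval_def by blast
    have f: "follows lo (node_word u p) lo" using param_interval_follows[OF i order_refl lo] .
    \<comment> \<open>Otherwise \<open>follows_lex\<close> would place the orbit point
      \<open>run a lo\<close>, where the factor starts, left of \<open>lo\<close>.\<close>
    have "\<not> (x = -1 \<and> y = -2)"
    proof
      assume xy: "x = -1 \<and> y = -2"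
      have "follows lo (b @ e) (run a lo)" using f unfolding less.prems(1) by (simp add: follows_append)
      then have 1: "follows lo (p' @ -1 # (b' @ e)) (run a lo)" using d(2) xy by simp
      have 2: "follows lo (p' @ -2 # v') lo" using f d(3) xy by simp
      have "run a lo < lo" using follows_lex[OF 1 2] .
      moreover have "lo \<le> run a lo" using f unfolding less.prems(1) by (auto simp: follows_append intro: follows_run)
      ultimately show False by simp
    qed
    then have xy: "x = -2" "y = -1" using xy by auto
    have "node_word u p = (p' @ [-1]) @ v'" using d(3) xy by simp
    from param_interval_lo_neg[OF nd inn i this order_refl] show ?thesis using red[of p' b'] d(2) xy by blast
  qed
qed

lemma left_less_twin:
  assumes nd: "node u p" and inn: "extendable (node_word u p)" and i: "param_interval u p lo ze"
  shows "run (node_word u p) (- t) < twin (- t)"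
proof -
  obtain c where c: "c \<le> n - 3" "node_word u p = replicate c (-1) \<or> (\<exists>r. node_word u p = replicate c (-1) @ -2 # r)"
    using inn unfolding extendable_def by blast
  have t0: "- t < 0" "- t < 1 - t" using t_ge_2 by auto
  from c(2) show ?thesis
  proof
    assume "node_word u p = replicate c (-1)"
    then show ?thesis using ones_less_twin[OF t0 c(1)] by simp
  next
    assume "\<exists>r. node_word u p = replicate c (-1) @ -2 # r"
    then obtain r where "node_word u p = replicate c (-1) @ -2 # r" by blast
    from factor_less_twin[OF nd inn i this c(1), of "[]" "node_word u p" "[]"] show ?thesis by simp
  qed
qed

text \<open>At -t the image is negative, hence below x + t = 0, so the concave quadratic is positive
  at the left end of the parameter range and has only one zero beyond it.\<close>

lemma zeta_unique:
  assumes nd: "node u p" and ad: "admissible (node_word u p)" and i: "param_interval u p lo ze" and x: "- t \<le> x"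
  shows "zeta_poly (node_word u p) x = 0 \<longleftrightarrow> x = ze"
proof -
  have lo: "lo < ze" "ze < 0" "- t < lo" "neg (node_word u p) ze" "run (node_word u p) ze = ze + t"
    using i unfolding param_interval_def by blast+
  have ze: "zeta_poly (node_word u p) ze = 0" using zeta_poly_zero_iff lo by simp
  have neg: "neg (node_word u p) (- t)" using neg_mono[OF lo(4)] lo by simp
  have "run (node_word u p) (- t) < 0"
    using ad unfolding admissible_def
  proof
    assume "extendable (node_word u p)"
    then show ?thesis using param_interval_lo_neg(2)[OF nd _ i, of "node_word u p" "[]" "- t"] by simp
  next
    assume v: "node_word u p = replicate (n - 2) (-1)"
    show ?thesis unfolding v using escape[of "- t" "n - 2"] by simp
  qed
  then have "0 < zeta_poly (node_word u p) (- t)" using zeta_poly_pos_iff[OF neg] by simp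
  moreover have "zeta_poly (node_word u p) ze \<le> 0" "- t < ze" using ze lo by auto
  ultimately show ?thesis
  proof (rule zeta_poly_crossing[OF neg])
    fix r
    assume "zeta_poly (node_word u p) r = 0"
      and pos: "\<And>x. - t \<le> x \<Longrightarrow> x < r \<Longrightarrow> 0 < zeta_poly (node_word u p) x"
      and neg': "\<And>x. r < x \<Longrightarrow> zeta_poly (node_word u p) x < 0"
    have *: "y = r" if "- t \<le> y" "zeta_poly (node_word u p) y = 0" for y
      using pos[OF that(1)] neg'[of y] that(2) by (cases y r rule: linorder_cases) auto
    show ?thesis using *[OF x] *[of ze] ze lo by auto
  qed
qed

lemma eta_unique:
  assumes nd: "node u p" and inn: "extendable (node_word u p)" and i: "param_interval u p lo ze"
    and et: "lo < et" "et < ze" "eta_poly (node_word u p) et = 0" and x: "- t \<le> x" "x \<le> 0"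
  shows "eta_poly (node_word u p) x = 0 \<longleftrightarrow> x = et"
proof -
  have lo: "ze < 0" "- t < lo" using i unfolding param_interval_def by blast+
  have neg: "neg (node_word u p) (- t)" "run (node_word u p) (- t) < 0"
    using param_interval_lo_neg[OF nd inn i, of "node_word u p" "[]" "- t"] by auto
  have t0: "- t < 0" using t_ge_2 by simp
  have 1: "0 < eta_poly (node_word u p) (- t)" using eta_poly_pos_iff[OF neg(1) t0] left_less_twin[OF nd inn i] by simp
  have 2: "eta_poly (node_word u p) et \<le> 0" "- t < et" "et < 0" "node_word u p \<noteq> []" using et lo by (auto simp: node_word_def)
  show ?thesis
  proof (rule eta_poly_crossing[OF neg 2(4) 1 2(1-3)])
    fix r
    assume "eta_poly (node_word u p) r = 0"
      and pos: "\<And>x. - t \<le> x \<Longrightarrow> x < r \<Longrightarrow> 0 < eta_poly (node_word u p) x"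
      and neg': "\<And>x. r < x \<Longrightarrow> x \<le> 0 \<Longrightarrow> eta_poly (node_word u p) x < 0"
    have *: "y = r" if "- t \<le> y" "y \<le> 0" "eta_poly (node_word u p) y = 0" for y
      using pos[OF that(1)] neg'[of y] that by (cases y r rule: linorder_cases) auto
    show ?thesis using *[OF x] *[of et] et lo by auto
  qed
qed

section \<open>The partition for parameter sets\<close>

lemma extendable_child_admissible:
  assumes nd: "node u p" and inn: "extendable (node_word u p)"
  shows "admissible (node_word (node_word u p) (rep m (node_prime u p) @ p))"
proof -
  obtain c where c: "1 \<le> c" "c \<le> n - 3" "node_word u p = replicate c (-1) \<or> (\<exists>r. node_word u p = replicate c (-1) @ -2 # r)"
    using inn unfolding extendable_def by blast
  from c(3) show ?thesis
  proof
    assume v: "node_word u p = replicate c (-1)"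
    have "set (node_word u p) \<subseteq> {-1}" unfolding v by auto
    then have p: "p = []" by (rule node_word_ones_imp[OF nd])
    have v': "node_word u [] = replicate c (-1)" using v p by simp
    show ?thesis
    proof (cases m)
      case 0
      have w: "node_word (node_word u p) (rep m (node_prime u p) @ p) = replicate (Suc c) (-1)"
        unfolding node_word_child unfolding p 0 v' by (simp add: replicate_append_same)
      show ?thesis
      proof (cases "Suc c \<le> n - 3")
        case True
        then show ?thesis unfolding w admissible_def extendable_def by (intro disjI1 exI[of _ "Suc c"]) auto
      next
        case False
        then have "Suc c = n - 2" using c n3 by simp
        then show ?thesis unfolding w admissible_def by simp
      qed
    next
      case (Suc k)
      have "\<exists>r. node_word (node_word u p) (rep m (node_prime u p) @ p) = replicate c (-1) @ -2 # r"
        unfolding node_word_child unfolding p Suc v' by (simp add: node_prime_def)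
      then show ?thesis using c unfolding admissible_def extendable_def by blast
    qed
  next
    assume "\<exists>r. node_word u p = replicate c (-1) @ -2 # r"
    then have "\<exists>r. node_word (node_word u p) (rep m (node_prime u p) @ p) = replicate c (-1) @ -2 # r"
      unfolding node_word_child by auto
    then show ?thesis using c unfolding admissible_def extendable_def by blast
  qed
qed

lemma params_child_iff:
  assumes nd: "node u p" and inn: "extendable (node_word u p)"
  shows "x \<in> params (node_word (node_word u p) (rep m (node_prime u p) @ p)) \<longleftrightarrow>
    x \<in> params (node_word u p) \<and> follows x (node_word (node_word u p) (rep m (node_prime u p) @ p)) x"
proof -
  let ?w = "node_word (node_word u p) (rep m (node_prime u p) @ p)"
  have sub: "set (node_word u p) \<subseteq> set ?w" unfolding node_word_child by auto
  have "gamma_pt \<le> x" if "\<not> set ?w \<subseteq> {-1}" "follows x ?w x" "- t \<le> x"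
  proof -
    have "extendable ?w" using extendable_child_admissible[OF assms, of m] that(1) unfolding admissible_def by fastforce
    then show ?thesis using extendable_gamma_pt_le that by blast
  qed
  then show ?thesis using sub unfolding params_def by (auto simp: follows_node_word_child)
qed

lemma params_partition:
  assumes nd: "node u p" and inn: "extendable (node_word u p)"
  shows "x \<in> params (node_word u p) \<longleftrightarrow> (x \<in> params (node_word u p) \<and> twin x \<le> run (node_word u p) x) \<or>
      (\<exists>m. x \<in> params (node_word (node_word u p) (rep m (node_prime u p) @ p)))"
    "x \<in> params (node_word (node_word u p) (rep i (node_prime u p) @ p)) \<Longrightarrow>
     x \<in> params (node_word (node_word u p) (rep j (node_prime u p) @ p)) \<Longrightarrow> i = j"
    "x \<in> params (node_word (node_word u p) (rep i (node_prime u p) @ p)) \<Longrightarrow> run (node_word u p) x < twin x"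
proof -
  have f: "follows x (node_word u p) x" if "x \<in> params (node_word u p)" using that by (simp add: params_def)
  have "\<exists>m. x \<in> params (node_word (node_word u p) (rep m (node_prime u p) @ p))"
    if "x \<in> params (node_word u p)" "\<not> twin x \<le> run (node_word u p) x"
    using ex_child[OF nd f[OF that(1)]] that unfolding params_child_iff[OF assms] not_le by blast
  then show "x \<in> params (node_word u p) \<longleftrightarrow> (x \<in> params (node_word u p) \<and> twin x \<le> run (node_word u p) x) \<or>
      (\<exists>m. x \<in> params (node_word (node_word u p) (rep m (node_prime u p) @ p)))"
    unfolding params_child_iff[OF assms] by blast
  show "i = j" if "x \<in> params (node_word (node_word u p) (rep i (node_prime u p) @ p))" "x \<in> params (node_word (node_word u p) (rep j (node_prime u p) @ p))"
    using that unfolding params_child_iff[OF assms] by (intro child_unique[of x u p i x j]) blast+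
  show "run (node_word u p) x < twin x" if "x \<in> params (node_word (node_word u p) (rep i (node_prime u p) @ p))"
    using child_imp_less_twin[OF nd] that unfolding params_child_iff[OF assms] by blast
qed

text \<open>Digit -1 moves negative points strictly to the right, so at \<open>lo\<close> the word
  and its parent cannot take the same value, and only the alternative with gamma is left.\<close>

lemma param_interval_ones:
  assumes "param_interval (replicate c (-1)) [] lo ze"
  shows "lo = gamma_pt"
proof -
  have v: "node_word (replicate c (-1)) [] = replicate c (-1) @ [-1]" by (simp add: node_word_def)
  have "lo < ze" using assms unfolding param_interval_def by blast
  then have "follows lo (replicate c (-1) @ [-1]) lo" using param_interval_follows[OF assms] v by simp
  then have "run (replicate c (-1)) lo < 0" by (simp add: follows_append del: fold_replicate)
  from branch_minus_one_greater[OF this] have "run (node_word (replicate c (-1)) []) lo \<noteq> run (replicate c (-1)) lo"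
    by (simp add: v del: fold_replicate)
  then show ?thesis using assms unfolding param_interval_def by blast
qed

text \<open>The powers of the matrix of digit -1, of trace 2 cos \<theta>, have entries s j / s 1 up
  to sign; the reflection s (n - j) = s j makes those of the power n - 2 polynomials in
  \<open>t\<close>. The outcome is the polynomial of gamma, so the last \<open>Jint\<close> starts
  there.\<close>

lemma eta_poly_last_ones: "eta_poly (replicate (n - 2) (-1)) x = x\<^sup>2 + (t - 1) * x - (t - 1)"
proof -
  define \<theta> where "\<theta> = pi / real n"
  \<comment> \<open>Indices are integers because the entry with s (j - 1) already occurs at j =
    0.\<close>
  define s where "s j = sin (of_int j * \<theta>)" for j :: int
  have t: "t = 1 + 2 * cos \<theta>" by (simp add: t_eq tpar_def \<theta>_def)
  have "pi / real n < pi / 1" using n3 by (intro divide_strict_left_mono) auto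
  then have \<theta>: "0 < \<theta>" "\<theta> < pi" using n3 by (auto simp: \<theta>_def)
  have n\<theta>: "of_int (int n - j) * \<theta> = pi - of_int j * \<theta>" for j
    using n3 by (simp add: \<theta>_def field_simps)
  have s_n: "s (int n - j) = s j" for j
    unfolding s_def n\<theta> by simp
  have rec: "s (j + 2) = (t - 1) * s (j + 1) - s j" for j
    using sin_times_cos[of "(of_int j + 1) * \<theta>" \<theta>] by (simp add: s_def t algebra_simps)
  have branch_mat: "s 1 * branch_mat (replicate j (-1)) $ 1 $ 1 = s (int j + 1) \<and>
    s 1 * branch_mat (replicate j (-1)) $ 1 $ 2 = s (int j) \<and>
    s 1 * branch_mat (replicate j (-1)) $ 2 $ 1 = - s (int j) \<and>
    s 1 * branch_mat (replicate j (-1)) $ 2 $ 2 = - s (int j - 1)" for j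
  proof (induction j)
    case 0
    then show ?case by (simp add: mat_def s_def)
  next
    case (Suc j)
    have "s (int j + 2) = (t - 1) * s (int j + 1) - s (int j)" "s (int j + 1) = (t - 1) * s (int j) - s (int j - 1)"
      using rec[of "int j"] rec[of "int j - 1"] by (simp_all add: add.commute[of 1])
    then show ?case using Suc
      unfolding replicate_Suc branch_mat_Cons_entries by (simp add: algebra_simps)
  qed
  have s1: "0 < s 1" using \<theta> by (simp add: s_def sin_gt_zero)
  have "s 2 = (t - 1) * s 1" using rec[of 0] by (simp add: s_def)
  moreover have "s 3 = (t - 1) * ((t - 1) * s 1) - s 1" using rec[of 1] calculation by simp
  moreover have "int (n - 2) + 1 = int n - 1" "int (n - 2) = int n - 2" "int (n - 2) - 1 = int n - 3"
    using n3 by auto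
  ultimately have "s 1 * branch_mat (replicate (n - 2) (-1)) $ 1 $ 1 = s 1 * 1 \<and>
    s 1 * branch_mat (replicate (n - 2) (-1)) $ 1 $ 2 = s 1 * (t - 1) \<and>
    s 1 * branch_mat (replicate (n - 2) (-1)) $ 2 $ 1 = s 1 * (- (t - 1)) \<and>
    s 1 * branch_mat (replicate (n - 2) (-1)) $ 2 $ 2 = s 1 * (1 - (t - 1)\<^sup>2)"
    using branch_mat[of "n - 2"] s_n by (simp add: power2_eq_square algebra_simps)
  then have e: "branch_mat (replicate (n - 2) (-1)) $ 1 $ 1 = 1" "branch_mat (replicate (n - 2) (-1)) $ 1 $ 2 = t - 1"
    "branch_mat (replicate (n - 2) (-1)) $ 2 $ 1 = - (t - 1)" "branch_mat (replicate (n - 2) (-1)) $ 2 $ 2 = 1 - (t - 1)\<^sup>2"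
    using s1 unfolding mult_cancel_left by auto
  show ?thesis unfolding eta_poly_def num_def den_def e by (simp add: power2_eq_square algebra_simps)
qed

end

section \<open>From digits to cylinders\<close>

lemma matrix_inv_eqI:
  fixes A B :: "'a::semiring_1^'n^'n"
  assumes "A ** B = mat 1" "B ** A = mat 1"
  shows "matrix_inv A = B"
proof -
  have "A ** matrix_inv A = mat 1 \<and> matrix_inv A ** A = mat 1"
    unfolding matrix_inv_def by (rule someI[of _ B]) (use assms in blast)
  then show ?thesis
    using assms by (metis matrix_mul_assoc matrix_mul_lid matrix_mul_rid)
qed

lemma mat2_eq_iff:
  "A = B \<longleftrightarrow> A$1$1 = B$1$1 \<and> A$1$2 = B$1$2 \<and> A$2$1 = B$2$1 \<and> A$2$2 = B$2$2"
  for A B :: "'a^2^2"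
  by (auto simp: vec_eq_iff forall_2)

lemma mat2_mult:
  "(A ** B)$i$j = A$i$1 * B$1$j + A$i$2 * B$2$j" for A B :: "real^2^2"
  by (simp add: matrix_matrix_mult_def sum_2)

lemma mat_pow_Suc: "mat_pow M (Suc k) = M ** mat_pow M k"
  by (simp add: mat_pow_def)

lemma mat_pow_0: "mat_pow M 0 = mat 1"
  by (simp add: mat_pow_def)

lemma mat_pow_1: "mat_pow M 1 = M"
  using mat_pow_Suc[of M 0] by (simp add: mat_pow_0)

lemma mat_pow_2: "mat_pow M 2 = M ** M"
  by (simp add: numeral_2_eq_2 mat_pow_Suc mat_pow_0)

lemma matC_entries: "matC$1$1 = -1" "matC$1$2 = 1" "matC$2$1 = -1" "matC$2$2 = 0"
  by (simp_all add: matC_def)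

lemma matrix_inv_matC: "matrix_inv matC = vector [vector [0, -1], vector [1, -1]]"
  by (rule matrix_inv_eqI) (simp_all add: mat2_eq_iff mat2_mult matC_entries mat_def)

context branch_maps
begin

lemma matA_entries: "matA n $1$1 = 1" "matA n $1$2 = t" "matA n $2$1 = 0" "matA n $2$2 = 1"
  by (simp_all add: matA_def t_eq)

lemma matrix_inv_matA: "matrix_inv (matA n) = vector [vector [1, - t], vector [0, 1]]"
  by (rule matrix_inv_eqI) (simp_all add: mat2_eq_iff mat2_mult matA_entries mat_def)

lemma digit_mat_entries: "digit_mat k $1$1 = - (1 + real_of_int k * t)" "digit_mat k $1$2 = 1" "digit_mat k $2$1 = -1" "digit_mat k $2$2 = 0"
  by (simp_all add: digit_mat_def)

lemma digit_mat_eq: "mat_powi (matA n) (-1) ** matC = digit_mat (-1)" "mat_powi (matA n) (-2) ** matC = digit_mat (-2)"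
proof -
  show "mat_powi (matA n) (-1) ** matC = digit_mat (-1)"
    by (simp add: mat_powi_def mat_pow_1[simplified] matrix_inv_matA mat2_eq_iff mat2_mult matC_entries digit_mat_entries)
  show "mat_powi (matA n) (-2) ** matC = digit_mat (-2)"
    by (simp add: mat_powi_def mat_pow_2 matrix_inv_matA mat2_eq_iff mat2_mult matC_entries digit_mat_entries)
qed

lemma moebius_digit_mat: "x \<noteq> 0 \<Longrightarrow> moebius (digit_mat k) (Fin x) = Fin (branch k x)"
  by (simp add: moebius_def digit_mat_entries branch_def field_simps)

lemma branch_mat_append: "branch_mat (u @ w) = branch_mat w ** branch_mat u"
  by (induction u) (simp_all add: matrix_mul_assoc)

lemma branch_mat_replicate: "branch_mat (replicate c k) = mat_pow (digit_mat k) c"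
proof (induction c)
  case 0
  then show ?case by (simp add: mat_pow_0)
next
  case (Suc c)
  have "branch_mat (replicate (Suc c) k) = branch_mat (replicate c k @ [k])" by (simp add: replicate_append_same)
  then show ?case unfolding branch_mat_append by (simp add: Suc mat_pow_Suc)
qed

lemma Wmat_eq: "Wmat n v = branch_mat (dword v)"
  by (induction v rule: dword.induct) (simp_all add: digit_mat_eq branch_mat_append branch_mat_replicate)

lemma digit_iff:
  assumes \<alpha>: "\<alpha> \<in> {0..1}" and z: "ell0 n \<alpha> \<le> z" "z < ell0 n \<alpha> + t" and k: "k \<in> {-1, -2}"
  shows "digit n \<alpha> (Fin z) = Some (k, 1) \<longleftrightarrow> z < 0 \<and> ell0 n \<alpha> \<le> branch k z \<and> branch k z < ell0 n \<alpha> + t"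
proof -
  have t0: "0 < t" using t_ge_2 by simp
  have ell: "ell0 n \<alpha> = (\<alpha> - 1) * t" by (simp add: ell0_def t_eq)
  define I where "I = {ell0 n \<alpha> ..< ell0 n \<alpha> + t}"
  have I: "Ialpha n \<alpha> = Fin ` I"
    by (simp add: Ialpha_def I_def ell0_def r0_def t_eq algebra_simps)
  define y where "y = 1 - 1 / z"
  have C1: "moebius (mat_pow matC 1) (Fin z) = (if z = 0 then Infty else Fin y)"
    unfolding mat_pow_1 by (simp add: moebius_def matC_entries y_def field_simps)
  have y: "branch k z = y + real_of_int k * t" by (simp add: branch_def y_def)
  have floor: "- \<lfloor>y / t + 1 - \<alpha>\<rfloor> = k \<longleftrightarrow> branch k z \<in> I"
  proof -
    have "- \<lfloor>y / t + 1 - \<alpha>\<rfloor> = k \<longleftrightarrow> \<lfloor>y / t + 1 - \<alpha>\<rfloor> = - k" by auto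
    also have "\<dots> \<longleftrightarrow> - real_of_int k \<le> y / t + 1 - \<alpha> \<and> y / t + 1 - \<alpha> < - real_of_int k + 1"
      by (simp add: floor_eq_iff)
    also have "\<dots> \<longleftrightarrow> \<alpha> - 1 - real_of_int k \<le> y / t \<and> y / t < \<alpha> - real_of_int k"
      by (auto simp: algebra_simps)
    also have "\<dots> \<longleftrightarrow> (\<alpha> - 1 - real_of_int k) * t \<le> y \<and> y < (\<alpha> - real_of_int k) * t"
      using t0 by (simp add: pos_le_divide_eq pos_divide_less_eq)
    also have "\<dots> \<longleftrightarrow> branch k z \<in> I" unfolding I_def y ell by (auto simp: algebra_simps)
    finally show ?thesis .
  qed
  \<comment> \<open>With r = \<alpha> t, a positive \<open>z\<close> is below r, while an image in
    range forces 1 / z \<le> 1 - r. Then r (1 - r) would exceed 1, but it is at most 1/4.\<close>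
  have negative: "z < 0" if "z \<noteq> 0" "branch k z \<in> I"
  proof (rule ccontr)
    assume "\<not> z < 0"
    then have z0: "0 < z" using that by simp
    have "- real_of_int k \<ge> 1" using k by auto
    then have "1 * t \<le> - real_of_int k * t" using t0 by (intro mult_right_mono) auto
    then have "ell0 n \<alpha> + t \<le> 1 - 1 / z" using that(2) by (simp add: I_def y y_def)
    then have "1 / z \<le> 1 - \<alpha> * t" by (simp add: ell algebra_simps)
    moreover have z': "z < \<alpha> * t" using z by (simp add: ell algebra_simps)
    moreover have "1 / (\<alpha> * t) < 1 / z" using z0 z' by (simp add: frac_less2)
    ultimately have less: "1 / (\<alpha> * t) < 1 - \<alpha> * t" by simp
    have "0 < \<alpha> * t" using z0 z' by simp
    then have "1 < (1 - \<alpha> * t) * (\<alpha> * t)" using less by (simp add: divide_less_eq)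
    moreover have "0 \<le> (\<alpha> * t - 1 / 2)\<^sup>2" by simp
    ultimately show False by (simp add: power2_eq_square algebra_simps)
  qed
  show ?thesis
  proof
    assume d: "digit n \<alpha> (Fin z) = Some (k, 1)"
    then have l: "exponentC n \<alpha> (Fin z) = 1"
      by (auto simp: digit_def Let_def split: proj_line.splits)
    have "z \<noteq> 0" using d C1 by (auto simp: digit_def l)
    moreover then have "- \<lfloor>y / t + 1 - \<alpha>\<rfloor> = k" using d C1 by (simp add: digit_def l t_eq)
    ultimately show "z < 0 \<and> ell0 n \<alpha> \<le> branch k z \<and> branch k z < ell0 n \<alpha> + t"
      using floor negative by (auto simp: I_def)
  next
    assume r: "z < 0 \<and> ell0 n \<alpha> \<le> branch k z \<and> branch k z < ell0 n \<alpha> + t"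
    then have brI: "branch k z \<in> I" by (simp add: I_def)
    have C1': "moebius (mat_pow matC 1) (Fin z) = Fin y" using C1 r by simp
    \<comment> \<open>The image under \<open>C\<close> lies at least \<open>t\<close> to the right
      of \<open>branch k z\<close>, so it is already outside the half-open interval and the exponent
      is 1.\<close>
    have "y \<notin> I"
    proof
      assume "y \<in> I"
      have "- real_of_int k \<ge> 1" using k by auto
      then have "1 * t \<le> - real_of_int k * t" using t0 by (intro mult_right_mono) auto
      then show False using \<open>y \<in> I\<close> brI by (simp add: I_def y)
    qed
    then have "exponentC n \<alpha> (Fin z) = 1"
      unfolding exponentC_def using C1' by (intro Least_equality) (auto simp: I)
    then show "digit n \<alpha> (Fin z) = Some (k, 1)"
      unfolding digit_def Let_def using C1' floor brI by (simp add: t_eq)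
  qed
qed

text \<open>Digit \<open>i\<close> is read off the orbit point reached after \<open>i\<close>
  digits, so both claims are proved together by adding digits at the end.\<close>

lemma follows_orbit:
  assumes \<alpha>: "\<alpha> \<in> {0..1}" and w: "set w \<subseteq> {-1, -2}"
  shows "(\<forall>i<length w. digit_seq n \<alpha> i = Some (w ! i, 1)) \<longleftrightarrow> follows (ell0 n \<alpha>) w (ell0 n \<alpha>)"
    "follows (ell0 n \<alpha>) w (ell0 n \<alpha>) \<Longrightarrow> orbit n \<alpha> (length w) = Some (Fin (run w (ell0 n \<alpha>)))"
  using w
proof (induction w rule: rev_induct)
  case Nil
  { case 1 then show ?case by simp }
  { case 2 then show ?case by simp }
next
  case (snoc k w)
  let ?l = "ell0 n \<alpha>"
  have k: "k \<in> {-1, -2}" and w: "set w \<subseteq> {-1, -2}" if "set (w @ [k]) \<subseteq> {-1, -2}"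
    using that by auto
  have t0: "0 < t" using t_ge_2 by simp
  have bounds: "?l \<le> run w ?l" "run w ?l < ?l + t" if "follows ?l w ?l"
    using follows_run[OF that] follows_run_less[OF that] t0 by (cases "w = []"; auto)+
  { case 1
    have "digit_seq n \<alpha> (length w) = Some (k, 1) \<longleftrightarrow> follows ?l [k] (run w ?l)" if f: "follows ?l w ?l"
      using snoc(2)[OF f w[OF 1]] digit_iff[OF \<alpha> bounds[OF f] k[OF 1]] by (simp add: digit_seq_def)
    then show ?case using snoc(1)[OF w[OF 1]]
      by (auto simp: follows_append nth_append less_Suc_eq)
  }
  { case 2
    then have f: "follows ?l w ?l" and fk: "follows ?l [k] (run w ?l)" by (auto simp: follows_append)
    have "digit n \<alpha> (Fin (run w ?l)) = Some (k, 1)"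
      using digit_iff[OF \<alpha> bounds[OF f] k[OF 2(2)]] fk by simp
    moreover have "mat_powi (matA n) k ** mat_pow matC 1 = digit_mat k"
      using k[OF 2(2)] digit_mat_eq unfolding mat_pow_1 by auto
    moreover have "run w ?l \<noteq> 0" using fk by auto
    ultimately have "Tmap n \<alpha> (Fin (run w ?l)) = Some (Fin (branch k (run w ?l)))"
      by (simp add: Tmap_def moebius_digit_mat)
    then show ?case using snoc(2)[OF f w[OF 2(2)]] by simp
  }
qed

section \<open>The affine coordinate and the distinguished parameters\<close>

lemma ell_inj: "ell0 n \<alpha> = ell0 n \<beta> \<longleftrightarrow> \<alpha> = \<beta>"
  using t_ge_2 by (simp add: ell0_def t_eq[symmetric])

lemma ell_less: "ell0 n \<alpha> < ell0 n \<beta> \<longleftrightarrow> \<alpha> < \<beta>"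
  using t_ge_2 by (simp add: ell0_def t_eq[symmetric] mult_less_cancel_right)

lemma ell_le: "ell0 n \<alpha> \<le> ell0 n \<beta> \<longleftrightarrow> \<alpha> \<le> \<beta>"
  using ell_less[of \<beta> \<alpha>] by (simp add: not_less[symmetric])

lemma ell_bounds: "\<alpha> \<in> {0..1} \<longleftrightarrow> - t \<le> ell0 n \<alpha> \<and> ell0 n \<alpha> \<le> 0"
  using ell_le[of 0 \<alpha>] ell_le[of \<alpha> 1] by (simp add: ell0_def t_eq)

lemma ell_surj: "ell0 n (1 + x / t) = x"
  using t_ge_2 by (simp add: ell0_def t_eq[symmetric])

lemma r0_eq: "r0 n \<alpha> = ell0 n \<alpha> + t"
  by (simp add: r0_def ell0_def t_eq algebra_simps)

text \<open>As \<alpha> and its coordinate determine each other, one equivalence supplies both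
  existence and uniqueness for a definite description.\<close>

lemma the_ell:
  assumes "\<And>\<alpha>. P \<alpha> \<longleftrightarrow> ell0 n \<alpha> = x"
  shows "ell0 n (THE \<alpha>. P \<alpha>) = x"
proof -
  have "P (THE \<alpha>. P \<alpha>)"
  proof (rule theI)
    show "P (1 + x / t)" using assms ell_surj by blast
    show "\<alpha> = 1 + x / t" if "P \<alpha>" for \<alpha>
      using that assms ell_surj ell_inj by metis
  qed
  then show ?thesis using assms by blast
qed

lemma ell_gamma: "ell0 n (gamma3 n) = gamma_pt"
proof -
  have iff: "\<alpha> \<in> {0<..<1} \<longleftrightarrow> - t < ell0 n \<alpha> \<and> ell0 n \<alpha> < 0" for \<alpha>
    using ell_less[of 0 \<alpha>] ell_less[of \<alpha> 1] by (simp add: ell0_def t_eq)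
  have "(\<alpha> \<in> {0<..<1} \<and> moebius (matrix_inv matC) (Fin (ell0 n \<alpha>)) = Fin (r0 n \<alpha>)) \<longleftrightarrow> ell0 n \<alpha> = gamma_pt" for \<alpha>
  proof -
    let ?x = "ell0 n \<alpha>"
    have "moebius (matrix_inv matC) (Fin ?x) = Fin (r0 n \<alpha>) \<longleftrightarrow> ?x\<^sup>2 + (t - 1) * ?x - (t - 1) = 0"
      if x: "?x < 0"
    proof -
      have m: "moebius (matrix_inv matC) (Fin ?x) = Fin (- 1 / (?x - 1))"
        using x by (simp add: matrix_inv_matC moebius_def)
      have "- 1 / (?x - 1) = ?x + t \<longleftrightarrow> - 1 = (?x + t) * (?x - 1)"
        using x by (subst divide_eq_eq) simp
      moreover have "(?x + t) * (?x - 1) + 1 = ?x\<^sup>2 + (t - 1) * ?x - (t - 1)"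
        by (simp add: power2_eq_square algebra_simps)
      ultimately show ?thesis unfolding r0_eq m proj_line.inject by linarith
    qed
    note root = this
    show ?thesis
    proof
      assume "\<alpha> \<in> {0<..<1} \<and> moebius (matrix_inv matC) (Fin ?x) = Fin (r0 n \<alpha>)"
      then show "?x = gamma_pt" unfolding iff using root by (intro gamma_pt_unique) auto
    next
      assume "?x = gamma_pt"
      then show "\<alpha> \<in> {0<..<1} \<and> moebius (matrix_inv matC) (Fin ?x) = Fin (r0 n \<alpha>)"
        unfolding iff using root gamma_pt_root gamma_pt_bounds(1) gamma_pt_neg by simp
    qed
  qed
  then show ?thesis unfolding gamma3_def by (rule the_ell)
qed

lemma zeta_poly_moebius: "moebius (Lmat n v ** matA n) (Fin x) = Fin (x + t) \<longleftrightarrow> zeta_poly (dword v) x = 0"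
proof -
  have "Lmat n v ** matA n = branch_mat (dword v)"
    unfolding Lmat_def Wmat_eq matrix_inv_matA
    by (simp add: mat2_eq_iff mat2_mult matA_entries algebra_simps)
  moreover have "Fin (x + t) = moebius (mat 1) (Fin (x + t))" by (simp add: moebius_def mat_def)
  moreover have "moebius (branch_mat (dword v)) (Fin x) = moebius (mat 1) (Fin (x + t)) \<longleftrightarrow> zeta_poly (dword v) x = 0"
  proof -
    have det: "det (branch_mat (dword v)) \<noteq> 0" "det (mat 1 :: real^2^2) \<noteq> 0" by (simp_all add: det_branch_mat det_I)
    show ?thesis unfolding moebius_Fin_eq_iff[OF det]
      by (auto simp: zeta_poly_def num_def den_def mat_def algebra_simps)
  qed
  ultimately show ?thesis by simp
qed

text \<open>The point x + t is \<open>A x\<close>, which cancels the inverse of \<open>A\<close> in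
  \<open>Lmat\<close>; as C has order 3, the equation says that \<open>v\<close> sends
  \<open>x\<close> to \<open>C^{-1} A C x\<close>, which is \<open>twin x\<close>.\<close>

lemma eta_poly_moebius:
  "moebius (matC ** matrix_inv (matA n) ** matC ** Lmat n v) (Fin (x + t))
     = moebius (matrix_inv matC) (Fin x) \<longleftrightarrow> eta_poly (dword v) x = 0"
proof -
  have det: "det (matC ** matrix_inv (matA n) ** matC ** Lmat n v) \<noteq> 0"
    unfolding Lmat_def Wmat_eq det_mul det_branch_mat
    by (simp add: det_2 matC_entries matrix_inv_matA)
  have det': "det (matrix_inv matC) \<noteq> 0" by (simp add: det_2 matrix_inv_matC)
  show ?thesis
    unfolding moebius_Fin_eq_iff[OF det det'] unfolding Lmat_def Wmat_eq
    by (simp add: mat2_mult matC_entries matrix_inv_matA matrix_inv_matC eta_poly_def num_def den_def algebra_simps)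
      argo
qed

lemma ell_zeta:
  assumes "node u p" "admissible (node_word u p)" "param_interval u p lo ze" "dword v = node_word u p"
  shows "ell0 n (zeta_v n v) = ze"
proof -
  have "- t < ze" "ze < 0" using assms(3) unfolding param_interval_def by auto
  then have "(\<alpha> \<in> {0..1} \<and> moebius (Lmat n v ** matA n) (Fin (ell0 n \<alpha>)) = Fin (r0 n \<alpha>)) \<longleftrightarrow> ell0 n \<alpha> = ze" for \<alpha>
    unfolding r0_eq zeta_poly_moebius ell_bounds assms(4) using zeta_unique[OF assms(1-3)] by auto
  then show ?thesis unfolding zeta_v_def by (rule the_ell)
qed

lemma ell_eta:
  assumes "- t \<le> et" "et \<le> 0" "\<And>x. - t \<le> x \<Longrightarrow> x \<le> 0 \<Longrightarrow> eta_poly (dword v) x = 0 \<longleftrightarrow> x = et"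
  shows "ell0 n (eta_v n v) = et"
proof -
  have "(\<alpha> \<in> {0..1} \<and> moebius (matC ** matrix_inv (matA n) ** matC ** Lmat n v) (Fin (r0 n \<alpha>))
       = moebius (matrix_inv matC) (Fin (ell0 n \<alpha>))) \<longleftrightarrow> ell0 n \<alpha> = et" for \<alpha>
    unfolding r0_eq eta_poly_moebius ell_bounds using assms by auto
  then show ?thesis unfolding eta_v_def by (rule the_ell)
qed

end

section \<open>Words and the operators Theta\<close>

definition child :: "nat \<Rightarrow> int list \<times> int list \<Rightarrow> int list \<times> int list" where
  "child m = (\<lambda>(u, p). (node_word u p, rep m (node_prime u p) @ p))"

text \<open>A node gets an address, the list of child indices leading to it from the root;
  \<open>path_unique\<close> recovers the address from the digits.\<close>

lemma node_path: "node u p \<Longrightarrow> \<exists>ms. (u, p) = fold child ms ([], [])"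
proof (induction rule: node.induct)
  case base
  show ?case by (rule exI[of _ "[]"]) simp
next
  case (step u p m)
  then obtain ms where "(u, p) = fold child ms ([], [])" by blast
  then have "(node_word u p, rep m (node_prime u p) @ p) = fold child (ms @ [m]) ([], [])"
    by (simp add: child_def flip: \<open>(u, p) = _\<close>)
  then show ?case by blast
qed

lemma path_extends: "\<exists>e. case_prod node_word (fold child ms x) = case_prod node_word x @ e \<and> (ms \<noteq> [] \<longrightarrow> e \<noteq> [])"
proof (induction ms arbitrary: x)
  case (Cons m ms)
  obtain e where e: "case_prod node_word (fold child ms (child m x)) = case_prod node_word (child m x) @ e"
    using Cons.IH by blast
  have "case_prod node_word (child m x) = case_prod node_word x @ rep m (case_prod node_prime x) @ snd x @ [-1]"
    by (simp add: child_def node_word_child split: prod.split)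
  then show ?case using e by auto
qed simp

text \<open>After \<open>v\<close>, \<open>m\<close> copies of \<open>v'\<close> and
  \<open>p\<close>, one sibling continues with -1 and the other with -2, so their subtrees share no
  word.\<close>

lemma siblings_incomparable:
  assumes "m < m'" shows "case_prod node_word (child m x) @ e \<noteq> case_prod node_word (child m' x) @ e'"
proof
  obtain u p where x: "x = (u, p)" by force
  obtain k where m': "m' = m + Suc k" using assms less_iff_Suc_add by auto
  have node_word_x: "case_prod node_word (child i x) = node_word u p @ rep i (node_prime u p) @ p @ [-1]" for i
    by (simp add: x child_def node_word_child)
  have rep_m': "rep m' (node_prime u p) = rep m (node_prime u p) @ p @ -2 # u @ rep k (node_prime u p)"
    unfolding m' rep_add rep_Suc by (simp add: node_prime_def[of u p])
  assume "case_prod node_word (child m x) @ e = case_prod node_word (child m' x) @ e'"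
  then show False unfolding node_word_x rep_m' by simp
qed

lemma path_unique:
  "case_prod node_word (fold child ms x) = case_prod node_word (fold child ms' x) \<Longrightarrow> ms = ms'"
proof (induction ms arbitrary: ms' x)
  case Nil
  then show ?case using path_extends[of ms' x] by auto
next
  case (Cons m ms)
  show ?case
  proof (cases ms')
    case Nil
    then show ?thesis using Cons.prems path_extends[of "m # ms" x] by auto
  next
    case ms': (Cons m' ks)
    obtain e e' where "case_prod node_word (fold child ms (child m x)) = case_prod node_word (child m x) @ e"
      "case_prod node_word (fold child ks (child m' x)) = case_prod node_word (child m' x) @ e'"
      using path_extends by blast
    then have "case_prod node_word (child m x) @ e = case_prod node_word (child m' x) @ e'"
      using Cons.prems ms' by simp
    then have "m = m'"
      using siblings_incomparable[of m m' x e e'] siblings_incomparable[of m' m x e' e] by (metis nat_neq_iff)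
    moreover then have "ms = ks" using Cons.prems ms' by (intro Cons.IH[of "child m x"]) simp
    ultimately show ?thesis using ms' by simp
  qed
qed

lemma node_unique:
  assumes "node u p" "node u' p'" "node_word u p = node_word u' p'" shows "u = u' \<and> p = p'"
proof -
  obtain ms ms' where ms: "(u, p) = fold child ms ([], [])" "(u', p') = fold child ms' ([], [])"
    using assms(1,2) node_path by meson
  have "case_prod node_word (fold child ms ([], [])) = case_prod node_word (fold child ms' ([], []))"
    using assms(3) unfolding ms[symmetric] by simp
  then have "ms = ms'" by (rule path_unique)
  then have "(u, p) = (u', p')" unfolding ms by (rule arg_cong)
  then show ?thesis by simp
qed

text \<open>\<open>eword\<close> is the counterpart of \<open>dword\<close> for words starting with a letter \<open>d\<^sub>i\<close>.\<close>

primrec eword :: "nat list \<Rightarrow> int list" where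
  "eword [] = []"
| "eword (d # w) = replicate d (-2) @ dword w"

lemma dword_Cons: "dword (c # w) = replicate c (-1) @ eword w"
  by (cases w) simp_all

lemma dword_eword_append:
  "(even (length v) \<longrightarrow> dword (v @ x) = dword v @ dword x \<and> eword (v @ x) = eword v @ eword x) \<and>
   (odd (length v) \<longrightarrow> dword (v @ x) = dword v @ eword x \<and> eword (v @ x) = eword v @ dword x)"
  by (induction v) (simp_all add: dword_Cons del: dword.simps(2,3))

lemmas dword_append = dword_eword_append[THEN conjunct2, rule_format, THEN conjunct1]
lemmas eword_append = dword_eword_append[THEN conjunct1, rule_format, THEN conjunct2]

definition wf_word :: "nat list \<Rightarrow> bool" where
  "wf_word v \<longleftrightarrow> odd (length v) \<and> (\<forall>x\<in>set v. 0 < x)"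

lemma replicate_split:
  assumes "replicate c a @ x = replicate c' a @ x'" "\<And>y. x \<noteq> a # y" "\<And>y. x' \<noteq> a # y"
  shows "c = c' \<and> x = x'"
  using assms(1)
proof (induction c arbitrary: c')
  case 0
  then show ?case using assms(2) by (cases c') auto
next
  case (Suc c)
  then show ?case using assms(3) by (cases c') fastforce+
qed

lemma dword_not_Cons: "\<forall>x\<in>set w. 0 < x \<Longrightarrow> dword w \<noteq> -2 # y"
  and eword_not_Cons: "\<forall>x\<in>set w. 0 < x \<Longrightarrow> eword w \<noteq> -1 # y"
proof -
  show "dword w \<noteq> -2 # y" if "\<forall>x\<in>set w. 0 < x"
    using that by (cases w) (auto simp: dword_Cons gr0_conv_Suc simp del: dword.simps(2,3))
  show "eword w \<noteq> -1 # y" if "\<forall>x\<in>set w. 0 < x"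
    using that by (cases w) (auto simp: gr0_conv_Suc)
qed

text \<open>Positive letters are the lengths of maximal runs. Stripping a run exchanges
  \<open>dword\<close> and \<open>eword\<close>, whence the joint claim.\<close>

lemma dword_inj_aux:
  "\<forall>x\<in>set v. 0 < x \<Longrightarrow> \<forall>x\<in>set w. 0 < x \<Longrightarrow>
    (dword v = dword w \<longrightarrow> v = w) \<and> (eword v = eword w \<longrightarrow> v = w)"
proof (induction v arbitrary: w)
  case Nil
  then show ?case by (cases w) (auto simp: dword_Cons simp del: dword.simps(2,3))
next
  case (Cons c v)
  show ?case
  proof (cases w)
    case Nil
    then show ?thesis using Cons.prems by (auto simp: dword_Cons simp del: dword.simps(2,3))
  next
    case w: (Cons c' w')
    have pos: "\<forall>x\<in>set v. 0 < x" "\<forall>x\<in>set w'. 0 < x" using Cons.prems w by auto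
    note nc = dword_not_Cons[OF pos(1)] dword_not_Cons[OF pos(2)] eword_not_Cons[OF pos(1)] eword_not_Cons[OF pos(2)]
    have "c # v = w" if "dword (c # v) = dword w"
    proof -
      have "c = c' \<and> eword v = eword w'"
        using that nc unfolding w dword_Cons by (intro replicate_split[of c "-1"]) auto
      then show ?thesis using Cons.IH[OF pos] w by simp
    qed
    moreover have "c # v = w" if "eword (c # v) = eword w"
    proof -
      have "c = c' \<and> dword v = dword w'"
        using that nc unfolding w eword.simps by (intro replicate_split[of c "-2"]) auto
      then show ?thesis using Cons.IH[OF pos] w by simp
    qed
    ultimately show ?thesis by blast
  qed
qed

lemma dword_inj: "wf_word v \<Longrightarrow> wf_word w \<Longrightarrow> dword v = dword w \<Longrightarrow> v = w"
  using dword_inj_aux unfolding wf_word_def by blast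

text \<open>On digits, the cases defining \<open>v'\<close> become one rule: the first -1 turns into
  -2. Reading by \<open>eword\<close> is right because \<open>v'\<close> is inserted after a word of
  odd length.\<close>

lemma eword_wprime:
  assumes "wf_word v" shows "eword (wprime v) = -2 # tl (dword v)"
  using assms
  by (cases v rule: wprime.cases) (auto simp: wf_word_def gr0_conv_Suc dword_Cons simp del: dword.simps(2,3))

lemma wf_wprime:
  assumes "wf_word v" shows "\<forall>x\<in>set (wprime v). 0 < x" "v \<noteq> [1] \<Longrightarrow> even (length (wprime v))"
  using assms by (cases v rule: wprime.cases; auto simp: wf_word_def)+

lemma wpow_rep: "wpow w q = rep (nat q) w"
  by (simp add: wpow_def rep_def)

lemma even_length_rep: "even (length w) \<Longrightarrow> even (length (rep k w))"
  by (induction k) auto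

lemma eword_rep: "even (length w) \<Longrightarrow> eword (rep k w) = rep k (eword w)"
  by (induction k) (simp_all add: eword_append)

text \<open>For a letter \<open>c > 1\<close>, child 0 is \<open>c + 1\<close> and the operator of
  index \<open>q\<close> contains q + 1 copies of \<open>v'\<close>. For the word 1, index 0 is
  missing and \<open>nat\<close> sends -1 to child 0.\<close>

definition child_index :: "nat list \<Rightarrow> int \<Rightarrow> nat" where
  "child_index v q = (if length v = 1 \<and> v \<noteq> [1] then nat (q + 1) else nat q)"

definition coded :: "int \<Rightarrow> nat list \<Rightarrow> nat list \<Rightarrow> bool" where
  "coded q v w \<longleftrightarrow> wf_word v \<and> wf_word w \<and> q \<in> qrange v \<and> (length w = 1 \<longleftrightarrow> q = -1) \<and>
    (\<exists>u p. node u p \<and> dword v = node_word u p \<and> dword w = node_word (node_word u p) (rep (child_index v q) (node_prime u p) @ p))"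

lemma Theta_rel_prefix: "Theta_rel q v w \<Longrightarrow> 0 \<le> q \<Longrightarrow> \<exists>v''. w = v @ v''"
  by (induction rule: Theta_rel.induct) auto

lemma rep_single: "rep k [a] = replicate k a"
  by (induction k) auto

lemma Theta_rel_coded: "Theta_rel q v w \<Longrightarrow> coded q v w"
proof (induction rule: Theta_rel.induct)
  case (minus_one c)
  then obtain c' where c: "c = Suc c'" by (cases c) auto
  have "wf_word [c]" "wf_word [c + 1]" "-1 \<in> qrange [c]" using minus_one by (auto simp: wf_word_def qrange_def)
  moreover have "child_index [c] (-1) = 0" by (simp add: child_index_def)
  moreover have "dword [c + 1] = node_word (node_word (replicate c' (-1)) []) (rep 0 (node_prime (replicate c' (-1)) []) @ [])"
    using node_ones[of c'] node_ones[of c] by (simp add: c)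
  moreover have "dword [c] = node_word (replicate c' (-1)) []" using node_ones[of c'] by (simp add: c)
  ultimately have "\<exists>u p. node u p \<and> dword [c] = node_word u p \<and>
      dword [c + 1] = node_word (node_word u p) (rep (child_index [c] (-1)) (node_prime u p) @ p)"
    using node_ones[of c'] by metis
  then show ?case using \<open>wf_word [c]\<close> \<open>wf_word [c + 1]\<close> \<open>-1 \<in> qrange [c]\<close>
    unfolding coded_def by simp
next
  case (one q)
  have "wf_word [1]" "wf_word [1, nat q, 1]" "q \<in> qrange [1]" using one by (auto simp: wf_word_def qrange_def)
  moreover have "dword [1, nat q, 1] = node_word (node_word [] []) (rep (nat q) (node_prime [] []) @ [])" "dword [1] = node_word [] []"
    by (simp_all add: node_word_def node_prime_def rep_single)
  moreover have "child_index [1] q = nat q" by (simp add: child_index_def)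
  ultimately have "\<exists>u p. node u p \<and> dword [1] = node_word u p \<and>
      dword [1, nat q, 1] = node_word (node_word u p) (rep (child_index [1] q) (node_prime u p) @ p)"
    using node.base by metis
  then show ?case using one \<open>wf_word [1]\<close> \<open>wf_word [1, nat q, 1]\<close> \<open>q \<in> qrange [1]\<close>
    unfolding coded_def by simp
next
  case (single c q)
  then obtain c' where c: "c = Suc c'" "0 < c'" by (cases c) auto
  let ?w = "[c] @ wpow [1, c - 1] q @ [1, c]"
  have "set (rep (nat q) [1, c - 1]) \<subseteq> {1, c - 1}" using set_rep_subset[of "nat q" "[1, c - 1]"] by simp
  moreover have "even (length (rep (nat q) [1, c - 1]))" by (simp add: even_length_rep)
  ultimately have "wf_word [c]" "wf_word ?w" "q \<in> qrange [c]" "length ?w \<noteq> 1"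
    using single by (auto simp: wf_word_def qrange_def wpow_rep)
  moreover have n: "node (replicate c' (-1)) []" "dword [c] = node_word (replicate c' (-1)) []"
    using node_ones[of c'] by (simp_all add: c)
  moreover have "dword ?w = node_word (dword [c]) (rep (Suc (nat q)) (node_prime (replicate c' (-1)) []) @ [])"
  proof -
    have e: "eword [1, c - 1] = node_prime (replicate c' (-1)) []" by (simp add: node_prime_def c)
    have "dword ?w = dword [c] @ rep (nat q) (node_prime (replicate c' (-1)) []) @ eword [1, c]"
      unfolding wpow_rep by (simp add: dword_append eword_append eword_rep even_length_rep e del: dword.simps eword.simps append_Cons One_nat_def)
    \<comment> \<open>The last letters 1 and \<open>c\<close> amount to one more copy of
      \<open>v'\<close>, with letters 1 and \<open>c - 1\<close>, and the closing -1; this causes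
      the shift of the index.\<close>
    also have "eword [1, c] = node_prime (replicate c' (-1)) [] @ [-1]"
      by (simp add: node_prime_def c replicate_append_same)
    finally show ?thesis
      by (simp only: node_word_def[of "dword [c]"] rep_comm_assoc rep_Suc append_Nil2 append_assoc append_Nil)
  qed
  moreover have "child_index [c] q = Suc (nat q)" using single by (simp add: child_index_def nat_add_distrib)
  ultimately show ?case using single unfolding coded_def by (metis neg_0_le_iff_le not_one_le_zero)
next
  case (step r x v v'' q)
  obtain u p where x: "wf_word x" "node u p" "dword x = node_word u p"
    and v: "wf_word v" "dword v = node_word (node_word u p) (rep (child_index x r) (node_prime u p) @ p)"
    using step.IH unfolding coded_def by blast
  define P where "P = rep (child_index x r) (node_prime u p) @ p"
  define m where "m = nat q"
  have nd: "node (node_word u p) P" unfolding P_def using x(2) by (rule node.step)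
  have odd_x: "odd (length x)" and odd_v: "odd (length v)" using x(1) v(1) by (auto simp: wf_word_def)
  have "dword v = node_word u p @ eword v''" using step.hyps(3) dword_append[OF odd_x] x(3) by simp
  then have ev'': "eword v'' = P @ [-1]" using v(2) by (simp add: P_def node_word_child)
  then have len: "1 < length v" using step.hyps(3) x(1) by (cases x; cases v'') (auto simp: wf_word_def)
  have even_v'': "even (length v'')" using odd_x odd_v step.hyps(3) by simp
  have v1: "v \<noteq> [1]" using len by auto
  have even': "even (length (wprime v))" using wf_wprime(2)[OF v(1) v1] .
  obtain w where w: "node_word (node_word u p) P = -1 # w" "node_prime (node_word u p) P = -2 # w" using nd by (rule node_tl)
  have ew: "eword (wprime v) = node_prime (node_word u p) P"
    using eword_wprime[OF v(1)] v(2) w by (simp add: P_def)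
  have ci: "child_index v q = m" using len by (simp add: child_index_def m_def)
  have dv: "dword v = node_word (node_word u p) P" using v(2) by (simp add: P_def)
  have "q \<noteq> -1" using step.hyps(4) by simp
  let ?w = "v @ wpow (wprime v) q @ v''"
  have "dword ?w = dword v @ rep m (node_prime (node_word u p) P) @ P @ [-1]"
    unfolding wpow_rep using odd_v even'
    by (simp add: dword_append eword_append eword_rep even_length_rep ew ev'' m_def)
  then have "dword ?w = node_word (node_word (node_word u p) P) (rep (child_index v q) (node_prime (node_word u p) P) @ P)"
    unfolding ci node_word_child using dv by simp
  moreover have "wf_word ?w"
    using v(1) wf_wprime(1)[OF v(1)] even' even_v'' step.hyps(3) set_rep_subset[of m "wprime v"]
    unfolding wf_word_def wpow_rep by (auto simp: even_length_rep m_def)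
  moreover have "q \<in> qrange v" using len v1 step.hyps(4) by (simp add: qrange_def)
  moreover have "length ?w \<noteq> 1" using len by simp
  ultimately show ?case unfolding coded_def using v(1) nd dv \<open>q \<noteq> -1\<close> by blast
qed

text \<open>The recursive rule leaves the split of \<open>v\<close> open, but the digits of
  \<open>v\<close> determine its node, and node and child index determine the digits of the
  result.\<close>

lemma Theta_rel_unique:
  assumes "Theta_rel q v w" "Theta_rel q v w'" shows "w = w'"
proof -
  obtain u p where 1: "wf_word w" "node u p" "dword v = node_word u p"
      "dword w = node_word (node_word u p) (rep (child_index v q) (node_prime u p) @ p)"
    using Theta_rel_coded[OF assms(1)] unfolding coded_def by blast
  obtain u' p' where 2: "wf_word w'" "node u' p'" "dword v = node_word u' p'"
      "dword w' = node_word (node_word u' p') (rep (child_index v q) (node_prime u' p') @ p')"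
    using Theta_rel_coded[OF assms(2)] unfolding coded_def by blast
  have "u = u' \<and> p = p'" using node_unique[OF 1(2) 2(2)] 1(3) 2(3) by simp
  then show ?thesis using dword_inj[OF 1(1) 2(1)] 1(4) 2(4) by simp
qed

lemma Vwords_node:
  assumes "v \<in> Vwords"
  shows "wf_word v \<and> (\<exists>u p. node u p \<and> dword v = node_word u p) \<and>
    (length v \<noteq> 1 \<longrightarrow> (\<exists>r x v''. 0 \<le> r \<and> Theta_rel r x v \<and> v = x @ v''))"
  using assms
proof induction
  case base
  have "node [] [] \<and> dword [1] = node_word [] []" using node.base by (simp add: node_word_def)
  then show ?case by (auto simp: wf_word_def)
next
  case (app v q w)
  have c: "coded q v w" using app.hyps(2) by (rule Theta_rel_coded)
  have "\<exists>r x v''. 0 \<le> r \<and> Theta_rel r x w \<and> w = x @ v''" if "length w \<noteq> 1"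
  proof -
    have "q \<noteq> -1" "q \<in> qrange v" using c that unfolding coded_def by auto
    then have "0 \<le> q" by (auto simp: qrange_def split: if_splits)
    then show ?thesis using Theta_rel_prefix app.hyps(2) by blast
  qed
  moreover have "wf_word w \<and> (\<exists>u p. node u p \<and> dword w = node_word u p)"
    using c node.step unfolding coded_def by blast
  ultimately show ?case by blast
qed

lemma Theta_rel_exists:
  assumes v: "v \<in> Vwords" and q: "q \<in> qrange v"
  shows "\<exists>w. Theta_rel q v w"
proof (cases "length v = 1")
  case True
  then obtain c where c: "v = [c]" by (auto simp: length_Suc_conv)
  have "0 < c" using Vwords_node[OF v] c by (simp add: wf_word_def)
  consider "q = -1" | "q \<noteq> -1" "c = 1" | "q \<noteq> -1" "1 < c" using \<open>0 < c\<close> by linarith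
  then show ?thesis
  proof cases
    case 1
    then show ?thesis using \<open>0 < c\<close> c Theta_rel.minus_one[of c] by auto
  next
    case 2
    then have "1 \<le> q" using q c by (auto simp: qrange_def)
    then show ?thesis using 2 c Theta_rel.one by blast
  next
    case 3
    then have "0 \<le> q" using q c by (auto simp: qrange_def)
    then show ?thesis using 3 c Theta_rel.single by blast
  qed
next
  case False
  then obtain r x v'' where "0 \<le> r" "Theta_rel r x v" "v = x @ v''" using Vwords_node[OF v] by blast
  moreover have "0 \<le> q" using q False by (auto simp: qrange_def split: if_splits)
  ultimately show ?thesis using Theta_rel.step by blast
qed

lemma Theta_coded:
  assumes "v \<in> Vwords" "q \<in> qrange v" shows "coded q v (Theta q v)"
proof -
  obtain w where w: "Theta_rel q v w" using Theta_rel_exists[OF assms] by blast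
  have "Theta q v = w" unfolding Theta_def using w Theta_rel_unique by blast
  then show ?thesis using Theta_rel_coded[OF w] by simp
qed

lemma child_index_bij: "bij_betw (child_index v) (qrange v) UNIV"
proof -
  define f where "f m = (if v = [1] then if m = 0 then -1 else int m else if length v = 1 then int m - 1 else int m)" for m
  show ?thesis
    by (rule bij_betwI[where g = f]) (auto simp: f_def child_index_def qrange_def split: if_splits)
qed

context branch_maps
begin

section \<open>Cylinders: partition, cover and the last word\<close>

lemma cylinder_iff:
  assumes "wf_word v" "dword v = node_word u p" "node u p"
  shows "\<alpha> \<in> cylinder n v \<longleftrightarrow> ell0 n \<alpha> \<in> params (node_word u p)"
proof -
  let ?l = "ell0 n \<alpha>"
  have single: "length v = 1 \<longleftrightarrow> set (node_word u p) \<subseteq> {-1}"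
    using assms(1) unfolding assms(2)[symmetric]
    by (cases v rule: dword.cases) (auto simp: wf_word_def gr0_conv_Suc)
  have gamma: "gamma3 n \<le> \<alpha> \<longleftrightarrow> gamma_pt \<le> ?l" using ell_le[of "gamma3 n" \<alpha>] by (simp add: ell_gamma)
  have neg: "?l < 0" if "follows ?l (node_word u p) ?l" using follows_node_word_neg[OF assms(3) that] .
  show ?thesis
  proof (cases "\<alpha> \<in> {0..1}")
    case True
    have "\<alpha> \<in> cylinder n v \<longleftrightarrow> follows ?l (node_word u p) ?l \<and> (length v = 1 \<longrightarrow> gamma3 n \<le> \<alpha>)"
      using follows_orbit(1)[OF True node_digits[OF assms(3)]] True unfolding cylinder_def assms(2) by simp
    then show ?thesis using True neg unfolding params_def single gamma ell_bounds by auto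
  next
    case False
    then show ?thesis unfolding cylinder_def params_def ell_bounds by auto
  qed
qed

lemma Vcheck_extendable:
  assumes "v \<in> Vcheck n - {[n - 2]}" "wf_word v"
  shows "extendable (dword v)"
proof -
  obtain c x where v: "v = c # x" using assms(2) by (cases v) (auto simp: wf_word_def)
  have "c \<le> n - 2" "c \<noteq> n - 2" using assms(1) unfolding Vcheck_def v by (auto split: if_splits)
  then have c: "1 \<le> c" "c \<le> n - 3" using assms(2) n3 by (auto simp: v wf_word_def)
  have "dword v = replicate c (-1) \<or> (\<exists>r. dword v = replicate c (-1) @ -2 # r)"
  proof (cases x)
    case Nil
    then show ?thesis by (simp add: v)
  next
    case (Cons d y)
    then obtain d' where "d = Suc d'" using assms(2) by (cases d) (auto simp: v wf_word_def)
    then show ?thesis by (simp add: v Cons)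
  qed
  then show ?thesis using c unfolding extendable_def by blast
qed

lemma Jint_iff:
  assumes nd: "node u p" and inn: "extendable (node_word u p)" and v: "dword v = node_word u p"
  shows "\<alpha> \<in> Jint n v \<longleftrightarrow> ell0 n \<alpha> \<in> params (node_word u p) \<and> twin (ell0 n \<alpha>) \<le> run (node_word u p) (ell0 n \<alpha>)"
proof -
  have ad: "admissible (node_word u p)" using inn by (simp add: admissible_def)
  obtain lo ze where i: "param_interval u p lo ze" using node_interval[OF nd ad] by blast
  have params: "params (node_word u p) = {lo..<ze}" and b: "ze < 0" "- t < lo" using i unfolding param_interval_def by blast+
  show ?thesis
  proof (rule param_interval_eta[OF nd inn i])
    fix et
    assume et: "lo < et" "et < ze" "eta_poly (node_word u p) et = 0"
      and less: "\<And>x. lo \<le> x \<Longrightarrow> x < et \<Longrightarrow> run (node_word u p) x < twin x"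
      and ge: "\<And>x. et \<le> x \<Longrightarrow> x < ze \<Longrightarrow> twin x \<le> run (node_word u p) x"
    have "ell0 n (eta_v n v) = et"
      using eta_unique[OF nd inn i et] et b unfolding v[symmetric] by (intro ell_eta) auto
    moreover have "ell0 n (zeta_v n v) = ze" using ell_zeta[OF nd ad i v] .
    ultimately have "\<alpha> \<in> Jint n v \<longleftrightarrow> et \<le> ell0 n \<alpha> \<and> ell0 n \<alpha> < ze"
      unfolding Jint_def using ell_le[of "eta_v n v" \<alpha>] ell_less[of \<alpha> "zeta_v n v"] by simp
    also have "\<dots> \<longleftrightarrow> ell0 n \<alpha> \<in> {lo..<ze} \<and> twin (ell0 n \<alpha>) \<le> run (node_word u p) (ell0 n \<alpha>)"
      using less[of "ell0 n \<alpha>"] ge[of "ell0 n \<alpha>"] et by (cases "et \<le> ell0 n \<alpha>") auto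
    finally show ?thesis unfolding params .
  qed
qed

lemma partition:
  assumes v: "v \<in> Vcheck n - {[n - 2]}"
  shows "cylinder n v = Jint n v \<union> (\<Union>q\<in>qrange v. cylinder n (Theta q v))"
    "disjoint_family_on (\<lambda>q. cylinder n (Theta q v)) (qrange v)"
    "q \<in> qrange v \<Longrightarrow> Jint n v \<inter> cylinder n (Theta q v) = {}"
proof -
  have V: "v \<in> Vwords" using v by (simp add: Vcheck_def)
  obtain u p where wf: "wf_word v" and nd: "node u p" and dv: "dword v = node_word u p"
    using Vwords_node[OF V] by blast
  have inn: "extendable (node_word u p)" using Vcheck_extendable[OF v wf] by (simp add: dv)
  note J = Jint_iff[OF nd inn dv]
  note part = params_partition[OF nd inn]
  have child: "\<alpha> \<in> cylinder n (Theta q v) \<longleftrightarrow>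
      ell0 n \<alpha> \<in> params (node_word (node_word u p) (rep (child_index v q) (node_prime u p) @ p))" if q: "q \<in> qrange v" for q \<alpha>
  proof -
    obtain u' p' where w: "wf_word (Theta q v)" "node u' p'" "dword v = node_word u' p'"
      "dword (Theta q v) = node_word (node_word u' p') (rep (child_index v q) (node_prime u' p') @ p')"
      using Theta_coded[OF V q] unfolding coded_def by blast
    have "u' = u \<and> p' = p" using node_unique[OF w(2) nd] w(3) dv by simp
    then show ?thesis using cylinder_iff[OF w(1,4) node.step[OF w(2)]] by simp
  qed
  have bij: "inj_on (child_index v) (qrange v)" "child_index v ` qrange v = UNIV"
    using child_index_bij[of v] by (auto simp: bij_betw_def)
  have ex: "(\<exists>q\<in>qrange v. P (child_index v q)) \<longleftrightarrow> (\<exists>m. P m)" for P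
    using bij(2) by (metis UNIV_I imageE)
  show "cylinder n v = Jint n v \<union> (\<Union>q\<in>qrange v. cylinder n (Theta q v))"
  proof (intro set_eqI)
    fix \<alpha>
    have "\<alpha> \<in> (\<Union>q\<in>qrange v. cylinder n (Theta q v)) \<longleftrightarrow>
      (\<exists>m. ell0 n \<alpha> \<in> params (node_word (node_word u p) (rep m (node_prime u p) @ p)))"
      using ex[of "\<lambda>m. ell0 n \<alpha> \<in> params (node_word (node_word u p) (rep m (node_prime u p) @ p))"] child by simp
    then show "\<alpha> \<in> cylinder n v \<longleftrightarrow> \<alpha> \<in> Jint n v \<union> (\<Union>q\<in>qrange v. cylinder n (Theta q v))"
      unfolding Un_iff J cylinder_iff[OF wf dv nd] using part(1)[of "ell0 n \<alpha>"] by blast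
  qed
  show "disjoint_family_on (\<lambda>q. cylinder n (Theta q v)) (qrange v)"
    unfolding disjoint_family_on_def
  proof (intro ballI impI equals0I)
    fix q r \<alpha> assume qr: "q \<in> qrange v" "r \<in> qrange v" "q \<noteq> r"
      and \<alpha>: "\<alpha> \<in> cylinder n (Theta q v) \<inter> cylinder n (Theta r v)"
    have "child_index v q = child_index v r"
      using part(2) \<alpha> child[OF qr(1)] child[OF qr(2)] by blast
    then show False using inj_onD[OF bij(1)] qr by blast
  qed
  show "Jint n v \<inter> cylinder n (Theta q v) = {}" if "q \<in> qrange v"
    using J child[OF that] part(3) by (auto simp: not_le[symmetric])
qed

lemma single_cylinder:
  assumes "1 \<le> c"
  shows "\<alpha> \<in> cylinder n [c] \<longleftrightarrow> ell0 n \<alpha> \<in> params (replicate c (-1))"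
    and "dword [c] = node_word (replicate (c - 1) (-1)) []"
proof -
  have w: "node_word (replicate (c - 1) (-1)) [] = replicate c (-1)" and nd: "node (replicate (c - 1) (-1)) []"
    using node_ones[of "c - 1"] assms by auto
  then show "dword [c] = node_word (replicate (c - 1) (-1)) []" by simp
  then show "\<alpha> \<in> cylinder n [c] \<longleftrightarrow> ell0 n \<alpha> \<in> params (replicate c (-1))"
    using cylinder_iff[of "[c]" "replicate (c - 1) (-1)" "[]" \<alpha>] nd w assms by (simp add: wf_word_def)
qed

text \<open>The equation for epsilon is the one for the right end of the word 1, whose branch is
  that of \<open>A^{-1} C\<close>.\<close>

lemma ell_epsilon:
  assumes "param_interval [] [] gamma_pt ze" shows "ell0 n (epsilon3 n) = ze"
proof -
  have node_word: "node_word [] [] = [-1]" by (simp add: node_word_def)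
  have ze: "- t < ze" "ze < 0" using assms gamma_pt_bounds unfolding param_interval_def by auto
  have iff: "\<alpha> \<in> {0<..<1} \<longleftrightarrow> - t < ell0 n \<alpha> \<and> ell0 n \<alpha> < 0" for \<alpha>
    using ell_less[of 0 \<alpha>] ell_less[of \<alpha> 1] by (simp add: ell0_def t_eq)
  have "matrix_inv (matA n) ** matC = Lmat n [1] ** matA n"
  proof -
    have "Lmat n [1] ** matA n = branch_mat (dword [1])"
      unfolding Lmat_def Wmat_eq matrix_inv_matA
      by (simp add: mat2_eq_iff mat2_mult matA_entries algebra_simps)
    also have "\<dots> = digit_mat (-1)" by simp
    also have "\<dots> = matrix_inv (matA n) ** matC"
      by (simp add: mat2_eq_iff mat2_mult matC_entries digit_mat_entries matrix_inv_matA)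
    finally show ?thesis ..
  qed
  moreover have "zeta_poly (dword [1]) x = 0 \<longleftrightarrow> x = ze" if "- t \<le> x" for x
    using zeta_unique[OF node.base _ assms that] admissible_one by (simp add: node_word)
  ultimately have "(\<alpha> \<in> {0<..<1} \<and> moebius (matrix_inv (matA n) ** matC) (Fin (ell0 n \<alpha>)) = Fin (r0 n \<alpha>))
      \<longleftrightarrow> ell0 n \<alpha> = ze" for \<alpha>
    unfolding iff r0_eq using ze zeta_poly_moebius[of "[1]" "ell0 n \<alpha>"] by auto
  then show ?thesis unfolding epsilon3_def by (rule the_ell)
qed

lemma params_ones_mono:
  assumes "c \<le> d" shows "params (replicate d (-1)) \<subseteq> params (replicate c (-1))"
proof
  fix x assume x: "x \<in> params (replicate d (-1))"
  obtain k where k: "d = c + k" using assms le_iff_add by blast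
  have "set (replicate j (-1 :: int)) \<subseteq> {-1}" for j by auto
  then show "x \<in> params (replicate c (-1))"
    using x unfolding params_def k replicate_add follows_append by (simp del: set_replicate_conv_if)
qed

text \<open>Cylinders of single letters shrink as the letter grows, so the union is its first
  member, whose end points are gamma and epsilon.\<close>

lemma cover: "{gamma3 n ..< epsilon3 n} = (\<Union>c\<in>{1..n - 2}. cylinder n [c])"
proof -
  obtain lo ze where i: "param_interval [] [] lo ze" using param_interval_base by blast
  have lo: "lo = gamma_pt" using param_interval_ones[of 0] i by simp
  have params: "params [-1] = {gamma_pt..<ze}" using i unfolding param_interval_def lo by (simp add: node_word_def)
  have eps: "ell0 n (epsilon3 n) = ze" using ell_epsilon i lo by simp
  have one: "\<alpha> \<in> cylinder n [1] \<longleftrightarrow> \<alpha> \<in> {gamma3 n ..< epsilon3 n}" for \<alpha>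
  proof -
    have "\<alpha> \<in> cylinder n [1] \<longleftrightarrow> ell0 n \<alpha> \<in> params [-1]"
      using single_cylinder(1)[of 1 \<alpha>] by simp
    then show ?thesis unfolding params atLeastLessThan_iff eps[symmetric] ell_gamma[symmetric] ell_le ell_less .
  qed
  have sub: "\<alpha> \<in> cylinder n [1]" if c: "1 \<le> c" and \<alpha>: "\<alpha> \<in> cylinder n [c]" for c \<alpha>
    using \<alpha> params_ones_mono[OF c] unfolding single_cylinder(1)[OF c] single_cylinder(1)[OF order_refl] by blast
  show ?thesis
  proof (intro set_eqI iffI)
    fix \<alpha> assume "\<alpha> \<in> {gamma3 n ..< epsilon3 n}"
    then have "\<alpha> \<in> cylinder n [1]" unfolding one .
    then show "\<alpha> \<in> (\<Union>c\<in>{1..n - 2}. cylinder n [c])" using n3 by (intro UN_I[of 1]) auto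
  next
    fix \<alpha> assume "\<alpha> \<in> (\<Union>c\<in>{1..n - 2}. cylinder n [c])"
    then obtain c where "1 \<le> c" "\<alpha> \<in> cylinder n [c]" by auto
    then show "\<alpha> \<in> {gamma3 n ..< epsilon3 n}" using sub unfolding one[symmetric] by blast
  qed
qed

lemma last_single:
  "cylinder n [n - 2] = {gamma3 n ..< zeta_v n [n - 2]}" "Jint n [n - 2] = {gamma3 n ..< zeta_v n [n - 2]}"
proof -
  have n2: "1 \<le> n - 2" and s: "Suc (n - 2 - 1) = n - 2" using n3 by auto
  have v: "node_word (replicate (n - 2 - 1) (-1)) [] = replicate (n - 2) (-1)" and nd: "node (replicate (n - 2 - 1) (-1)) []"
    using node_ones[of "n - 2 - 1", unfolded s] by blast+
  have ad: "admissible (node_word (replicate (n - 2 - 1) (-1)) [])" unfolding v admissible_def by simp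
  obtain lo ze where i: "param_interval (replicate (n - 2 - 1) (-1)) [] lo ze" using node_interval[OF nd ad] by blast
  have lo: "lo = gamma_pt" using param_interval_ones i by blast
  have params: "params (replicate (n - 2) (-1)) = {gamma_pt..<ze}" using i unfolding param_interval_def lo v by simp
  have zeta: "ell0 n (zeta_v n [n - 2]) = ze" using ell_zeta[OF nd ad i single_cylinder(2)[OF n2]] .
  have "\<alpha> \<in> cylinder n [n - 2] \<longleftrightarrow> \<alpha> \<in> {gamma3 n ..< zeta_v n [n - 2]}" for \<alpha>
    unfolding single_cylinder(1)[OF n2] params atLeastLessThan_iff zeta[symmetric] ell_gamma[symmetric] ell_le ell_less ..
  then show "cylinder n [n - 2] = {gamma3 n ..< zeta_v n [n - 2]}" by blast
  have "ell0 n (eta_v n [n - 2]) = gamma_pt"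
  proof (rule ell_eta)
    show "eta_poly (dword [n - 2]) x = 0 \<longleftrightarrow> x = gamma_pt" if "- t \<le> x" "x \<le> 0" for x
      using gamma_pt_root gamma_pt_unique[OF _ that(2)] by (auto simp: eta_poly_last_ones)
  qed (use gamma_pt_bounds gamma_pt_neg in auto)
  then have "eta_v n [n - 2] = gamma3 n" using ell_inj ell_gamma by metis
  then show "Jint n [n - 2] = {gamma3 n ..< zeta_v n [n - 2]}" by (simp add: Jint_def)
qed

end

theorem theorem68:
  fixes n :: nat
  assumes "3 \<le> n"
  shows "{gamma3 n ..< epsilon3 n} = (\<Union>c\<in>{1..n - 2}. cylinder n [c])
    \<and> (\<forall>v \<in> Vcheck n - {[n - 2]}.
         cylinder n v = Jint n v \<union> (\<Union>q\<in>qrange v. cylinder n (Theta q v)) \<and>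
         disjoint_family_on (\<lambda>q. cylinder n (Theta q v)) (qrange v) \<and>
         (\<forall>q\<in>qrange v. Jint n v \<inter> cylinder n (Theta q v) = {}))
    \<and> cylinder n [n - 2] = Jint n [n - 2]
    \<and> Jint n [n - 2] = {gamma3 n ..< zeta_v n [n - 2]}"
proof -
  interpret branch_maps n "tpar n"
    using assms by unfold_locales simp_all
  show ?thesis
    using last_single by (intro conjI ballI cover partition) simp_all
qed

end
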